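(* Let $h$ be hyperbolic with respect to $\mathbf{e}$ and let $\mathbf{v}_1,\dots,\mathbf{v}_m\in\Lambda_+(h,\mathbf{e})$. Then $$\lambda_{\max}(\mathbf{v}_1+\cdots+\mathbf{v}_m)\leq\lambda_{\max}(\mathbf{v}_1,\dots,\mathbf{v}_m)\quad\text{and}\quad\lambda_{\min}(\mathbf{v}_1+\cdots+\mathbf{v}_m)\geq\lambda_{\min}(\mathbf{v}_1,\dots,\mathbf{v}_m).$$
   Context: $h\in\mathbb{R}[x_1,\dots,x_n]$ homogeneous of degree $d$ is hyperbolic with respect to $\mathbf{e}$ if $h(\mathbf{e})\neq0$ and $t\mapsto h(t\mathbf{e}-\mathbf{x})$ has only real zeros for all $\mathbf{x}$; write $h(t\mathbf{e}-\mathbf{x})=h(\mathbf{e})\prod_{j=1}^d(t-\lambda_j(\mathbf{x}))$, $\lambda_{\max}(\mathbf{x})$, $\lambda_{\min}(\mathbf{x})$ being the largest and smallest of the $\lambda_j(\mathbf{x})$; $\Lambda_+(h,\mathbf{e})=\{\mathbf{x}:\lambda_{\min}(\mathbf{x})\geq0\}$. $D_{\mathbf{v}}h=\sum_kv_k\partial h/\partial x_k$. The mixed characteristic polynomial of $\mathbf{v}_1,\dots,\mathbf{v}_m$ is the (real-rooted, degree $d$) polynomial $t\mapsto(1-D_{\mathbf{v}_1})\cdots(1-D_{\mathbf{v}_m})h(t\mathbf{e})$; $\lambda_{\max}(\mathbf{v}_1,\dots,\mathbf{v}_m)$ and $\lambda_{\min}(\mathbf{v}_1,\dots,\mathbf{v}_m)$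 denote its largest and smallest zeros. *)

theory Defs
  imports "HOL-Analysis.Analysis" "HOL-Computational_Algebra.Computational_Algebra"
begin

text \<open>Elements of $R[x_1,\dots,x_n]$ are represented by the polynomial functions on
  \<^typ>\<open>real ^ 'n\<close> they induce; this is faithful since the reals are infinite. The sum ranges over
  the (finitely many) exponent vectors of total degree \<open>d\<close>.\<close>

definition homogeneous_polynomial :: "nat \<Rightarrow> (real ^ 'n \<Rightarrow> real) \<Rightarrow> bool" where
  "homogeneous_polynomial d h \<longleftrightarrow>
     (\<exists>c :: ('n \<Rightarrow> nat) \<Rightarrow> real.
        \<forall>x. h x = (\<Sum>\<alpha> | (\<Sum>i\<in>UNIV. \<alpha> i) = d. c \<alpha> * (\<Prod>i\<in>UNIV. (x $ i) ^ \<alpha> i)))"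

text \<open>The zeros of \<open>t \<mapsto> h (t e - x)\<close> are its complex zeros, so we pass to the (unique)
  univariate polynomial \<open>p\<close> inducing this function and view it over the complex numbers.\<close>

definition hyperbolic :: "(real ^ 'n \<Rightarrow> real) \<Rightarrow> real ^ 'n \<Rightarrow> bool" where
  "hyperbolic h e \<longleftrightarrow>
     h e \<noteq> 0 \<and>
     (\<forall>x. \<exists>p :: real poly.
        (\<forall>t. poly p t = h (t *\<^sub>R e - x)) \<and>
        (\<forall>z :: complex. poly (map_poly complex_of_real p) z = 0 \<longrightarrow> z \<in> \<real>))"

text \<open>The multiset of the \<open>\<lambda>\<^sub>j(x)\<close>; it exists and is unique when \<open>h\<close> is a homogeneous
  polynomial that is hyperbolic with respect to \<open>e\<close>.\<close>

definition eigenvalues :: "(real ^ 'n \<Rightarrow> real) \<Rightarrow> real ^ 'n \<Rightarrow> real ^ 'n \<Rightarrow> real multiset" where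
  "eigenvalues h e x =
     (THE L. \<forall>t. h (t *\<^sub>R e - x) = h e * (\<Prod>l\<in>#L. t - l))"

definition lambda_max :: "(real ^ 'n \<Rightarrow> real) \<Rightarrow> real ^ 'n \<Rightarrow> real ^ 'n \<Rightarrow> real" where
  "lambda_max h e x = Max (set_mset (eigenvalues h e x))"

definition lambda_min :: "(real ^ 'n \<Rightarrow> real) \<Rightarrow> real ^ 'n \<Rightarrow> real ^ 'n \<Rightarrow> real" where
  "lambda_min h e x = Min (set_mset (eigenvalues h e x))"

definition hyperbolicity_cone :: "(real ^ 'n \<Rightarrow> real) \<Rightarrow> real ^ 'n \<Rightarrow> (real ^ 'n) set" where
  "hyperbolicity_cone h e = {x. lambda_min h e x \<ge> 0}"

definition partial_deriv :: "'n \<Rightarrow> (real ^ 'n \<Rightarrow> real) \<Rightarrow> real ^ 'n \<Rightarrow> real" where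
  "partial_deriv k h x = deriv (\<lambda>s. h (x + s *\<^sub>R axis k 1)) 0"

definition dir_deriv :: "real ^ 'n \<Rightarrow> (real ^ 'n \<Rightarrow> real) \<Rightarrow> real ^ 'n \<Rightarrow> real" where
  "dir_deriv v h x = (\<Sum>k\<in>UNIV. v $ k * partial_deriv k h x)"

text \<open>For \<open>vs = [v\<^sub>1, \<dots>, v\<^sub>m]\<close> the operator $(1 - D_{v_1}) \cdots (1 - D_{v_m})$ is applied to \<open>h\<close>
  in \<open>n\<close> variables first, and only then is the result restricted to the line spanned by \<open>e\<close>.\<close>

definition mixed_char_poly ::
    "(real ^ 'n \<Rightarrow> real) \<Rightarrow> real ^ 'n \<Rightarrow> (real ^ 'n) list \<Rightarrow> real \<Rightarrow> real" where
  "mixed_char_poly h e vs t = foldr (\<lambda>v g x. g x - dir_deriv v g x) vs h (t *\<^sub>R e)"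

definition mixed_lambda_max :: "(real ^ 'n \<Rightarrow> real) \<Rightarrow> real ^ 'n \<Rightarrow> (real ^ 'n) list \<Rightarrow> real" where
  "mixed_lambda_max h e vs = Max {t. mixed_char_poly h e vs t = 0}"

definition mixed_lambda_min :: "(real ^ 'n \<Rightarrow> real) \<Rightarrow> real ^ 'n \<Rightarrow> (real ^ 'n) list \<Rightarrow> real" where
  "mixed_lambda_min h e vs = Min {t. mixed_char_poly h e vs t = 0}"

end

theory Submission
  imports Defs
begin

text \<open>Write \<open>h(te - v\<^sub>1 - \<dots> - v\<^sub>m)\<close> as the result of applying the \<open>m\<close> commuting translations
  $e^{-D_{v_i}}$ to \<open>h\<close> and replace them one at a time by $1 - D_{v_i}$. All intermediate polynomials
  do not vanish at \<open>x + iy\<close> for \<open>y\<close> in a tube around the cone (Garding), so they are real-rooted along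
  \<open>e\<close> and along \<open>v\<^sub>i\<close>, and the region above all zeros is invariant under translation by \<open>v\<^sub>i\<close>.
  A replacement therefore only concerns the restriction \<open>q\<close> of a polynomial to a line in direction
  \<open>v\<^sub>i\<close>, where it says that the largest zero of $q - q'$ is at least one more than that of \<open>q\<close>.
  The smallest zeros are treated by the same argument for \<open>-e\<close> and \<open>-v\<^sub>i\<close>, which amounts to the
  univariate statement that the largest zero of $q + q'$ is at least that of \<open>q\<close> minus one.\<close>

subsection \<open>Real-rooted univariate polynomials\<close>

definition roots_poly :: "'a::comm_ring_1 multiset \<Rightarrow> 'a poly" where
  "roots_poly L = (\<Prod>l\<in>#L. [:-l, 1:])"

lemma poly_roots_poly: "poly (roots_poly L) x = (\<Prod>l\<in>#L. x - l)"
  unfolding roots_poly_def by (induction L) (auto simp: algebra_simps)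

lemma roots_poly_add: "roots_poly (add_mset l L) = [:-l, 1:] * roots_poly L"
  unfolding roots_poly_def by simp

lemma poly_roots_poly_add: "poly (roots_poly (add_mset l L)) x = (x - l) * poly (roots_poly L) x"
  by (simp add: poly_roots_poly)

lemma poly_pderiv_roots_poly_add:
  fixes l x :: "'a::idom"
  shows "poly (pderiv (roots_poly (add_mset l L))) x
    = poly (roots_poly L) x + (x - l) * poly (pderiv (roots_poly L)) x"
  by (simp only: roots_poly_add pderiv_mult) (simp add: pderiv_pCons algebra_simps)

lemma lead_coeff_roots_poly [simp]: "lead_coeff (roots_poly (L :: 'a::idom multiset)) = 1"
  by (induction L) (simp_all only: roots_poly_add lead_coeff_mult, simp_all add: roots_poly_def)

lemma degree_roots_poly [simp]: "degree (roots_poly (L :: 'a::idom multiset)) = size L"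
proof (induction L)
  case (add l L)
  have "roots_poly L \<noteq> 0" using lead_coeff_roots_poly[of L] by (metis leading_coeff_0_iff zero_neq_one)
  then have "degree ([:-l, 1:] * roots_poly L) = degree [:-l, 1:] + degree (roots_poly L)"
    by (intro degree_mult_eq) auto
  then show ?case using add by (simp add: roots_poly_add)
qed (simp add: roots_poly_def)

lemma poly_roots_poly_eq_0_iff: "poly (roots_poly (L :: 'a::idom multiset)) x = 0 \<longleftrightarrow> x \<in># L"
  by (auto simp: poly_roots_poly prod_mset_zero_iff)

lemma complex_poly_roots_poly:
  fixes p :: "complex poly"
  obtains L where "size L = degree p" "p = smult (lead_coeff p) (roots_poly L)"
proof (cases "p = 0")
  case True
  then show ?thesis using that[of "{#}"] by simp
next
  case False
  then show ?thesis using alg_closed_imp_factorization[of p] that unfolding roots_poly_def by blast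
qed

text \<open>Over the complex numbers \<open>qc\<close> splits, and by \<open>rr\<close> all its
  zeros are real, so on the real line \<open>q\<close> is a multiple of the product over their real
  parts.\<close>

lemma real_rooted_splits:
  fixes q :: "real poly" and qc :: "complex poly"
  assumes ext: "\<And>s. poly qc (complex_of_real s) = of_real (poly q s)"
    and rr: "\<And>z. poly qc z = 0 \<Longrightarrow> Im z = 0"
  obtains L where "q = smult (lead_coeff q) (roots_poly L)"
proof -
  obtain A where A: "qc = smult (lead_coeff qc) (roots_poly A)"
    using complex_poly_roots_poly .
  let ?c = "lead_coeff qc"
  let ?L = "image_mset Re A"
  have nz: "qc \<noteq> 0" using rr[of \<i>] by auto
  have "\<forall>l\<in>#A. l = of_real (Re l)"
  proof
    fix l assume "l \<in># A"
    then have "poly qc l = 0" using A by (metis mult_zero_right poly_roots_poly_eq_0_iff poly_smult)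
    then show "l = of_real (Re l)" using rr by (simp add: complex_eq_iff)
  qed
  then have ev: "poly (roots_poly A) (of_real s) = of_real (poly (roots_poly ?L) s)" for s
    unfolding poly_roots_poly by (induction A) auto
  have "finite (set_mset ?L)" by simp
  then obtain s0 where s0: "s0 \<notin># ?L" using ex_new_if_finite infinite_UNIV_char_0 by blast
  then have r0: "poly (roots_poly ?L) s0 \<noteq> 0" by (simp add: poly_roots_poly_eq_0_iff)
  have e: "of_real (poly q s) = ?c * of_real (poly (roots_poly ?L) s)" for s
    using ext[of s] A ev[of s] by (metis poly_smult)
  \<comment> \<open>Evaluation at a real point off the zeros exhibits the leading coefficient as a
    quotient of real numbers.\<close>
  have "?c = of_real (poly q s0 / poly (roots_poly ?L) s0)"
    using e[of s0] r0 by simp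
  then obtain r where r: "?c = of_real r" by blast
  have "poly q s = poly (smult r (roots_poly ?L)) s" for s
    using e[of s] unfolding r by (metis of_real_eq_iff of_real_mult poly_smult)
  then have "q = smult r (roots_poly ?L)" by (simp add: poly_eq_poly_eq_iff[symmetric] fun_eq_iff)
  moreover from this have "lead_coeff q = r"
    by (simp only: lead_coeff_smult lead_coeff_roots_poly mult_1_right)
  ultimately show ?thesis using that[of ?L] by metis
qed

section \<open>Largest zeros of \<open>q - q'\<close> and \<open>q + q'\<close>\<close>

lemma pderiv_roots_poly_nonneg:
  fixes x :: real
  assumes "\<forall>l\<in>#L. l \<le> x"
  shows "poly (pderiv (roots_poly L)) x \<ge> 0"
  using assms
proof (induction L)
  case (add l L)
  have "poly (roots_poly L) x \<ge> 0"
    using add.prems unfolding poly_roots_poly by (induction L) auto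
  with add show ?case by (simp add: poly_roots_poly_add poly_pderiv_roots_poly_add)
qed (simp add: roots_poly_def)

lemma poly_root_ge:
  fixes p :: "real poly"
  assumes "lead_coeff p > 0" "poly p a \<le> 0"
  shows "\<exists>x\<ge>a. poly p x = 0"
proof -
  obtain n where n: "\<And>x. x \<ge> n \<Longrightarrow> poly p x \<ge> lead_coeff p"
    using poly_pinfty_gt_lc[OF assms(1)] by blast
  let ?b = "max a n"
  have "poly p ?b \<ge> 0" using n[of ?b] assms(1) by simp
  moreover have "continuous_on {a..?b} (poly p)" by (intro continuous_intros)
  ultimately show ?thesis using IVT'[of "poly p" a 0 ?b] assms(2) by auto
qed

lemma lead_coeff_add_smult_pderiv:
  fixes q :: "real poly"
  shows "degree (q + smult a (pderiv q)) = degree q" "lead_coeff (q + smult a (pderiv q)) = lead_coeff q"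
proof -
  have *: "coeff (q + smult a (pderiv q)) (degree q) = lead_coeff q"
    by (simp add: coeff_pderiv coeff_eq_0)
  have "degree (smult a (pderiv q)) \<le> degree q"
    by (metis degree_pderiv degree_smult_le diff_le_self le_trans)
  then have le: "degree (q + smult a (pderiv q)) \<le> degree q" by (simp add: degree_add_le)
  show d: "degree (q + smult a (pderiv q)) = degree q"
  proof (cases "q = 0")
    case False
    then show ?thesis using * le by (metis le_antisym le_degree leading_coeff_0_iff)
  qed simp
  show "lead_coeff (q + smult a (pderiv q)) = lead_coeff q" using * d by simp
qed

text \<open>With \<open>q = (x - r) p\<close>, the value of \<open>q - q'\<close> at
  \<open>r + 1\<close> is \<open>- p'\<close>, which is nonpositive because no zero of
  \<open>p\<close> exceeds \<open>r\<close>. Since \<open>q - q'\<close> is monic, it has a zero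
  further right.\<close>

lemma exists_root_minus_pderiv:
  fixes L :: "real multiset"
  assumes r: "r \<in># L" "\<forall>l\<in>#L. l \<le> r"
  defines "q \<equiv> roots_poly L"
  shows "\<exists>s\<ge>r + 1. poly q s - poly (pderiv q) s = 0"
proof -
  obtain L' where L: "L = add_mset r L'" using r(1) by (metis multi_member_split)
  let ?p = "roots_poly L'"
  have "poly (pderiv ?p) (r + 1) \<ge> 0"
    using r L by (intro pderiv_roots_poly_nonneg) auto
  then have "poly (q + smult (-1) (pderiv q)) (r + 1) \<le> 0"
    unfolding q_def L by (simp add: poly_roots_poly_add poly_pderiv_roots_poly_add)
  then have "\<exists>s\<ge>r+1. poly (q + smult (-1) (pderiv q)) s = 0"
    by (rule poly_root_ge[rotated], subst lead_coeff_add_smult_pderiv(2)) (simp only: q_def lead_coeff_roots_poly)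
  then show ?thesis by simp
qed

text \<open>If a second zero lies in the unit interval below the largest zero \<open>r\<close>, Rolle's theorem for
  $e^s q(s)$ applies; otherwise $q + q'$ is nonpositive at $r - 1$.\<close>

lemma exists_root_plus_pderiv:
  fixes L :: "real multiset"
  assumes r: "r \<in># L" "\<forall>l\<in>#L. l \<le> r"
  defines "q \<equiv> roots_poly L"
  shows "\<exists>s\<ge>r - 1. poly q s + poly (pderiv q) s = 0"
proof -
  obtain L' where L: "L = add_mset r L'" using r(1) by (metis multi_member_split)
  let ?p = "roots_poly L'"
  show ?thesis
  proof (cases "\<exists>l\<in>#L'. l > r - 1")
    case False
    then have "poly (pderiv ?p) (r - 1) \<ge> 0" by (intro pderiv_roots_poly_nonneg) auto
    \<comment> \<open>At \<open>r - 1\<close> the factor \<open>x - r\<close> equals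
      \<open>-1\<close>, so \<open>q + q'\<close> equals \<open>- p'\<close> there.\<close>
    then have "poly (q + smult 1 (pderiv q)) (r - 1) \<le> 0"
      unfolding q_def L by (simp add: poly_roots_poly_add poly_pderiv_roots_poly_add)
    then have "\<exists>s\<ge>r-1. poly (q + smult 1 (pderiv q)) s = 0"
      by (rule poly_root_ge[rotated], subst lead_coeff_add_smult_pderiv(2)) (simp only: q_def lead_coeff_roots_poly)
    then show ?thesis by simp
  next
    case True
    then obtain l where l: "l \<in># L'" "l > r - 1" by blast
    have lr: "l \<le> r" using l r L by auto
    show ?thesis
    proof (cases "l = r")
      case True
      then have "poly ?p r = 0" using l by (simp add: poly_roots_poly_eq_0_iff)
      then have "poly q r + poly (pderiv q) r = 0"
        unfolding q_def L by (simp add: poly_roots_poly_add poly_pderiv_roots_poly_add)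
      then show ?thesis by (intro exI[of _ r]) simp
    next
      case False
      with lr have "l < r" by simp
      moreover have "poly q l = 0" "poly q r = 0"
        using l L by (auto simp: q_def poly_roots_poly_eq_0_iff)
      moreover have D: "((\<lambda>s. exp s * poly q s) has_real_derivative
          exp s * (poly q s + poly (pderiv q) s)) (at s)" for s
        by (auto intro!: derivative_eq_intros simp: algebra_simps)
      moreover have "continuous_on {l..r} (\<lambda>s. exp s * poly q s)" by (intro continuous_intros)
      ultimately obtain s where "l < s" "s < r"
          "(*) (exp s * (poly q s + poly (pderiv q) s)) = (\<lambda>_. 0)"
        using Rolle_deriv[of l r "\<lambda>s. exp s * poly q s" "\<lambda>s. (*) (exp s * (poly q s + poly (pderiv q) s))"]
        by (auto simp: has_field_derivative_def)
      then have "l < s" "poly q s + poly (pderiv q) s = 0" by (auto dest: fun_cong[of _ _ 1])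
      then show ?thesis using l(2) by (intro exI[of _ s]) auto
    qed
  qed
qed

text \<open>Both signs in one form: the zero at 0 makes the largest zero \<open>r\<close>
  nonnegative, so a zero beyond \<open>r + \<epsilon>\<close> is also beyond
  \<open>\<epsilon>\<close>. For \<open>c = 0\<close> there is nothing to find.\<close>

lemma exists_root_shift:
  fixes q :: "real poly"
  assumes q: "q = smult c (roots_poly L)" and q0: "poly q 0 = 0" and eps: "\<epsilon> = 1 \<or> \<epsilon> = -1"
  shows "\<exists>s\<ge>\<epsilon>. poly q s - \<epsilon> * poly (pderiv q) s = 0"
proof (cases "c = 0")
  case False
  then have 0: "0 \<in># L" using q q0 by (simp add: poly_roots_poly_eq_0_iff)
  define r where "r = Max (set_mset L)"
  have r: "r \<in># L" "\<forall>l\<in>#L. l \<le> r" unfolding r_def using 0 by (auto intro: Max_in)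
  then have "r \<ge> 0" using 0 by auto
  have "\<exists>s\<ge>r+\<epsilon>. poly (roots_poly L) s - \<epsilon> * poly (pderiv (roots_poly L)) s = 0"
    using exists_root_minus_pderiv[OF r] exists_root_plus_pderiv[OF r] eps by auto
  then obtain s where s: "s \<ge> r+\<epsilon>" "poly (roots_poly L) s - \<epsilon> * poly (pderiv (roots_poly L)) s = 0"
    by blast
  have "poly q s - \<epsilon> * poly (pderiv q) s
      = c * (poly (roots_poly L) s - \<epsilon> * poly (pderiv (roots_poly L)) s)"
    unfolding q by (simp add: pderiv_smult algebra_simps)
  then show ?thesis using s \<open>r \<ge> 0\<close> by (intro exI[of _ s]) simp
qed (use q in auto)

text \<open>The logarithmic derivative at 0 is the sum of the \<open>- 1 / l\<close>, and
  \<open>1 / l\<close> lies in the upper half plane when \<open>l\<close> lies in the lower one. The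
  empty sum is listed separately.\<close>

lemma Im_logderiv_roots_poly:
  assumes "\<forall>l\<in>#L. Im l < 0"
  defines "p \<equiv> roots_poly L"
  shows "poly p 0 \<noteq> 0 \<and> (L = {#} \<or> Im (poly (pderiv p) 0 / poly p 0) < 0)"
  using assms(1) unfolding p_def
proof (induction L)
  case (add l L)
  let ?p = "roots_poly L"
  have l: "Im l < 0" "l \<noteq> 0" using add.prems by auto
  have IH: "poly ?p 0 \<noteq> 0" "L = {#} \<or> Im (poly (pderiv ?p) 0 / poly ?p 0) < 0"
    using add by auto
  have "poly (pderiv (roots_poly (add_mset l L))) 0 / poly (roots_poly (add_mset l L)) 0
      = poly (pderiv ?p) 0 / poly ?p 0 - 1 / l"
    using l IH(1) by (simp add: poly_roots_poly_add poly_pderiv_roots_poly_add field_simps)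
  moreover have "Im (1 / l) > 0" using l by (simp add: Im_divide complex_eq_iff sum_power2_gt_zero_iff divide_neg_pos)
  moreover have "Im (poly (pderiv ?p) 0 / poly ?p 0) \<le> 0"
    using IH(2) by (auto simp: roots_poly_def)
  ultimately show ?case using l IH(1) by (simp add: poly_roots_poly_add)
qed (simp add: roots_poly_def)

text \<open>A zero would give \<open>\<epsilon> p'(0) / p(0) = 1\<close>, so \<open>p' / p\<close>
  would be real at 0, although its imaginary part is negative for nonconstant \<open>p\<close>. For
  constant \<open>p\<close> the derivative drops out.\<close>

lemma stable_poly_minus_pderiv:
  fixes p :: "complex poly"
  assumes "\<And>z. Im z \<ge> 0 \<Longrightarrow> poly p z \<noteq> 0"
  shows "poly p 0 - of_real \<epsilon> * poly (pderiv p) 0 \<noteq> 0"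
proof
  assume eq: "poly p 0 - of_real \<epsilon> * poly (pderiv p) 0 = 0"
  obtain L where p: "p = smult (lead_coeff p) (roots_poly L)" using complex_poly_roots_poly .
  let ?c = "lead_coeff p"
  have c: "?c \<noteq> 0" using assms[of 0] by auto
  have "\<forall>l\<in>#L. Im l < 0"
  proof
    fix l assume "l \<in># L"
    then have "poly p l = 0" using p by (metis mult_zero_right poly_roots_poly_eq_0_iff poly_smult)
    then show "Im l < 0" using assms[of l] by force
  qed
  note * = Im_logderiv_roots_poly[OF this]
  let ?a = "poly (roots_poly L) 0" and ?b = "poly (pderiv (roots_poly L)) 0"
  have "?c * (?a - of_real \<epsilon> * ?b) = 0"
    using eq by (subst (asm) p, subst (asm) (3) p) (simp add: pderiv_smult algebra_simps)
  then have e1: "?a = of_real \<epsilon> * ?b" using c by simp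
  show False
  proof (cases "L = {#}")
    case True
    then show False using * e1 by (simp add: roots_poly_def pderiv_1)
  next
    case False
    have "of_real \<epsilon> * (?b / ?a) = 1" using e1 * by simp
    moreover have "Im (of_real \<epsilon> * (?b / ?a)) = \<epsilon> * Im (?b / ?a)"
      by (simp only: times_complex.sel Re_complex_of_real Im_complex_of_real mult_zero_left add_0_right)
    ultimately have "\<epsilon> * Im (?b / ?a) = 0" "\<epsilon> \<noteq> 0" by auto
    then show False using * False by simp
  qed
qed

subsection \<open>Continuation of zeros\<close>

text \<open>Every linear factor has modulus at least \<delta> at \<open>z0\<close>. Read
  contrapositively, a small value at \<open>z0\<close> forces a zero nearby, which is how zeros
  persist under perturbation.\<close>

lemma norm_poly_ge_root_distance:
  fixes p :: "complex poly"
  assumes "\<And>z. dist z0 z < \<delta> \<Longrightarrow> poly p z \<noteq> 0" "\<delta> \<ge> 0"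
  shows "norm (poly p z0) \<ge> norm (lead_coeff p) * \<delta> ^ degree p"
proof -
  obtain L where L: "size L = degree p" "p = smult (lead_coeff p) (roots_poly L)"
    using complex_poly_roots_poly .
  have "\<forall>l\<in>#L. \<delta> \<le> dist z0 l"
  proof
    fix l assume "l \<in># L"
    then have "poly p l = 0" using L(2) by (metis mult_zero_right poly_roots_poly_eq_0_iff poly_smult)
    then show "\<delta> \<le> dist z0 l" using assms(1)[of l] by force
  qed
  then have "\<delta> ^ size L \<le> norm (poly (roots_poly L) z0)"
    unfolding poly_roots_poly
    by (induction L) (auto simp: norm_mult dist_norm \<open>\<delta> \<ge> 0\<close> intro!: mult_mono)
  moreover have "norm (poly p z0) = norm (lead_coeff p) * norm (poly (roots_poly L) z0)"
    by (subst L(2)) (simp only: poly_smult norm_mult)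
  ultimately show ?thesis using L(1) by (simp add: mult_left_mono)
qed

text \<open>Cauchy's bound: for \<open>norm z > 1\<close> the lower terms have modulus at most
  \<open>n M |z|^(n-1)\<close> in total and must balance the leading term. It confines the zeros of
  a family to one disc.\<close>

lemma norm_root_le:
  fixes p :: "complex poly"
  assumes M: "\<And>j. norm (coeff p j) \<le> M" and m: "m > 0" "norm (lead_coeff p) \<ge> m" and z: "poly p z = 0"
  shows "norm z \<le> 1 + real (degree p) * M / m"
proof (cases "norm z \<le> 1")
  case True
  have "M \<ge> 0" using M[of 0] norm_ge_zero order_trans by blast
  then show ?thesis using True m by (simp add: add_increasing2)
next
  case False
  define n where "n = degree p"
  have "n \<noteq> 0"
  proof
    assume "n = 0"
    then obtain c where "p = [:c:]" unfolding n_def by (metis degree_eq_zeroE)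
    then show False using z m by simp
  qed
  then obtain k where k: "n = Suc k" by (cases n) auto
  have "0 = (\<Sum>i<n. coeff p i * z ^ i) + lead_coeff p * z ^ n"
    using z unfolding poly_altdef n_def[symmetric] by (simp add: lessThan_Suc_atMost[symmetric])
  then have "norm (lead_coeff p * z ^ n) = norm (\<Sum>i<n. coeff p i * z ^ i)"
    by (metis add_eq_0_iff norm_minus_cancel)
  also have "\<dots> \<le> (\<Sum>i<n. M * norm z ^ k)"
  proof (rule sum_norm_le)
    fix i assume "i \<in> {..<n}"
    then have "norm z ^ i \<le> norm z ^ k" using False k by (intro power_increasing) auto
    then show "norm (coeff p i * z ^ i) \<le> M * norm z ^ k"
      unfolding norm_mult norm_power
      by (intro mult_mono M order_trans[OF norm_ge_zero[of "coeff p 0"] M]) auto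
  qed
  finally have "norm (lead_coeff p) * norm z ^ n \<le> real n * M * norm z ^ k"
    by (simp add: norm_mult norm_power)
  moreover have "m * norm z ^ n \<le> norm (lead_coeff p) * norm z ^ n" using m by (simp add: mult_right_mono)
  ultimately have "(m * norm z) * norm z ^ k \<le> (real n * M) * norm z ^ k" unfolding k by (simp add: algebra_simps)
  then have "m * norm z \<le> real n * M"
  proof (rule mult_right_le_imp_le)
    have "norm z > 0" using False by linarith
    then show "norm z ^ k > 0" by (rule zero_less_power)
  qed
  then have "norm z \<le> real n * M / m" using m by (simp add: field_simps)
  then show ?thesis unfolding n_def by simp
qed

text \<open>As long as the degree does not drop, zeros move continuously; hence the set of parameters
  for which there is a zero in \<open>U\<close> is open and closed.\<close>

lemma no_roots_continuation:
  fixes P :: "real \<Rightarrow> complex poly"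
  assumes deg: "\<And>\<theta>. \<theta> \<in> {0..1} \<Longrightarrow> degree (P \<theta>) \<le> d"
    and lead: "\<And>\<theta>. \<theta> \<in> {0..1} \<Longrightarrow> coeff (P \<theta>) d \<noteq> 0"
    and cont: "\<And>j. continuous_on {0..1} (\<lambda>\<theta>. coeff (P \<theta>) j)"
    and U: "open U"
    and fr: "\<And>\<theta> z. \<theta> \<in> {0..1} \<Longrightarrow> z \<in> frontier U \<Longrightarrow> poly (P \<theta>) z \<noteq> 0"
    and init: "\<And>z. z \<in> U \<Longrightarrow> poly (P 0) z \<noteq> 0"
    and z: "z \<in> U"
  shows "poly (P 1) z \<noteq> 0"
proof -
  let ?I = "{0..1} :: real set"
  have dg: "degree (P \<theta>) = d" if "\<theta> \<in> ?I" for \<theta>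
    using deg[OF that] lead[OF that] by (simp add: le_antisym le_degree)
  have P: "poly (P \<theta>) z = (\<Sum>i\<le>d. coeff (P \<theta>) i * z ^ i)" if "\<theta> \<in> ?I" for \<theta> z
    using dg[OF that] by (simp add: poly_altdef)
  let ?F = "\<lambda>x :: real \<times> complex. \<Sum>i\<le>d. coeff (P (fst x)) i * snd x ^ i"
  have contF: "continuous_on (?I \<times> S) ?F" for S
    by (intro continuous_intros continuous_on_compose2[OF cont]) auto
  obtain m where m: "m > 0" "\<And>\<theta>. \<theta> \<in> ?I \<Longrightarrow> norm (coeff (P \<theta>) d) \<ge> m"
  proof -
    have "continuous_on ?I (\<lambda>\<theta>. norm (coeff (P \<theta>) d))" by (intro continuous_intros cont)
    from continuous_attains_inf[OF _ _ this]
    obtain \<theta>0 where t0: "\<theta>0 \<in> ?I" "\<forall>\<theta>\<in>?I. norm (coeff (P \<theta>0) d) \<le> norm (coeff (P \<theta>) d)" by auto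
    show ?thesis using that[of "norm (coeff (P \<theta>0) d)"] t0 lead[of \<theta>0] by simp
  qed
  obtain M where M: "\<And>\<theta> j. \<theta> \<in> ?I \<Longrightarrow> norm (coeff (P \<theta>) j) \<le> M"
  proof -
    have "continuous_on ?I (\<lambda>\<theta>. \<Sum>j\<le>d. norm (coeff (P \<theta>) j))" by (intro continuous_intros cont)
    from continuous_attains_sup[OF _ _ this] obtain \<theta>1 where
      t1: "\<theta>1 \<in> ?I" "\<forall>\<theta>\<in>?I. (\<Sum>j\<le>d. norm (coeff (P \<theta>) j)) \<le> (\<Sum>j\<le>d. norm (coeff (P \<theta>1) j))" by auto
    have "norm (coeff (P \<theta>) j) \<le> (\<Sum>j\<le>d. norm (coeff (P \<theta>1) j))" if "\<theta> \<in> ?I" for \<theta> j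
    proof (cases "j \<le> d")
      case True
      then have "norm (coeff (P \<theta>) j) \<le> (\<Sum>j\<le>d. norm (coeff (P \<theta>) j))"
        by (intro member_le_sum) auto
      also have "\<dots> \<le> (\<Sum>j\<le>d. norm (coeff (P \<theta>1) j))" using t1 that by blast
      finally show ?thesis .
    next
      case False
      then show ?thesis using dg[OF that] by (simp add: coeff_eq_0 sum_nonneg)
    qed
    then show ?thesis using that by blast
  qed
  \<comment> \<open>The bounds \<open>m\<close> and \<open>M\<close> are uniform in \<theta>, so one
    radius serves the whole family.\<close>
  define R where "R = 1 + real d * M / m"
  have R: "norm z \<le> R" if "\<theta> \<in> ?I" "poly (P \<theta>) z = 0" for \<theta> z
    using norm_root_le[of "P \<theta>" M m z] m that M dg[of \<theta>] unfolding R_def by auto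
  define B where "B = {\<theta>\<in>?I. \<exists>z\<in>U. poly (P \<theta>) z = 0}"
  \<comment> \<open>A zero in \<open>closure U\<close> lies in \<open>U\<close>, the frontier being
    free of zeros; thus \<open>B\<close> is the projection of a compact set.\<close>
  have "B = fst ` {x \<in> ?I \<times> (closure U \<inter> cball 0 R). ?F x = 0}" (is "_ = fst ` ?K")
  proof (intro equalityI subsetI)
    fix \<theta> assume "\<theta> \<in> B"
    then obtain z where z: "\<theta> \<in> ?I" "z \<in> U" "poly (P \<theta>) z = 0" unfolding B_def by auto
    then have "(\<theta>, z) \<in> ?K" using R closure_subset[of U] P by auto
    then show "\<theta> \<in> fst ` ?K" by force
  next
    fix \<theta> assume "\<theta> \<in> fst ` ?K"
    then obtain z where z: "\<theta> \<in> ?I" "z \<in> closure U" "poly (P \<theta>) z = 0" using P by auto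
    then have "z \<in> U" using fr[of \<theta> z] U by (auto simp: frontier_def interior_open)
    then show "\<theta> \<in> B" using z unfolding B_def by auto
  qed
  moreover have "compact ?K"
  proof -
    have c: "compact (?I \<times> (closure U \<inter> cball 0 R))" by (intro compact_Times closed_Int_compact) auto
    then have "closed ?K" by (intro continuous_closed_preimage_constant contF compact_imp_closed)
    moreover have "bounded ?K" by (rule bounded_subset[OF compact_imp_bounded[OF c]]) blast
    ultimately show ?thesis using compact_eq_bounded_closed by blast
  qed
  ultimately have "compact B" by (simp only: compact_continuous_image[OF continuous_on_fst[OF continuous_on_id]])
  then have cl: "closedin (top_of_set ?I) B"
    by (intro closed_subset) (auto simp: B_def compact_imp_closed)
  \<comment> \<open>Openness: without a zero in \<open>ball z0 \<delta>\<close> the value at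
    \<open>z0\<close> would have modulus at least \<open>m * \<delta> ^ d\<close>, but by continuity
    in \<theta> it is smaller.\<close>
  have op: "openin (top_of_set ?I) B"
    unfolding openin_euclidean_subtopology_iff
  proof (intro conjI ballI)
    show "B \<subseteq> ?I" by (auto simp: B_def)
    fix \<theta>0 assume "\<theta>0 \<in> B"
    then obtain z0 where z0: "\<theta>0 \<in> ?I" "z0 \<in> U" "poly (P \<theta>0) z0 = 0" unfolding B_def by auto
    obtain \<delta> where \<delta>: "\<delta> > 0" "ball z0 \<delta> \<subseteq> U" using U z0(2) openE by blast
    have m\<delta>: "m * \<delta> ^ d > 0" using m(1) \<delta>(1) by simp
    have "continuous_on ?I (\<lambda>\<theta>. \<Sum>i\<le>d. coeff (P \<theta>) i * z0 ^ i)" by (intro continuous_intros cont)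
    then obtain e where e: "e > 0" "\<And>\<theta>. \<theta> \<in> ?I \<Longrightarrow> dist \<theta> \<theta>0 < e \<Longrightarrow>
        dist (\<Sum>i\<le>d. coeff (P \<theta>) i * z0 ^ i) (\<Sum>i\<le>d. coeff (P \<theta>0) i * z0 ^ i) < m * \<delta> ^ d"
      using z0(1) m\<delta> unfolding continuous_on_iff by blast
    have "\<theta> \<in> B" if t: "\<theta> \<in> ?I" "dist \<theta> \<theta>0 < e" for \<theta>
    proof (rule ccontr)
      assume "\<theta> \<notin> B"
      then have "norm (poly (P \<theta>) z0) \<ge> norm (lead_coeff (P \<theta>)) * \<delta> ^ degree (P \<theta>)"
        using \<delta> t(1) by (intro norm_poly_ge_root_distance) (auto simp: B_def)
      moreover have "norm (lead_coeff (P \<theta>)) * \<delta> ^ degree (P \<theta>) \<ge> m * \<delta> ^ d"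
        using m(2)[OF t(1)] dg[OF t(1)] \<delta>(1) by (simp add: mult_right_mono)
      moreover have "norm (poly (P \<theta>) z0) < m * \<delta> ^ d"
        using e(2)[OF t] z0(3) P[OF t(1), of z0] P[OF z0(1), of z0] by (simp add: dist_norm)
      ultimately show False by linarith
    qed
    then show "\<exists>e>0. \<forall>x'\<in>?I. dist x' \<theta>0 < e \<longrightarrow> x' \<in> B" using e(1) by blast
  qed
  have "B = {} \<or> B = ?I" using connected_clopen[of ?I] op cl by auto
  moreover have "0 \<notin> B" using init unfolding B_def by auto
  ultimately have "1 \<notin> B" by auto
  then show ?thesis using z unfolding B_def by auto
qed

text \<open>For a split real polynomial $|q(x + iy)|$ increases with $|y|$, so a nonreal zero of a
  pointwise limit forces the limit to vanish on a whole segment.\<close>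

lemma norm_roots_poly_mono:
  assumes "0 \<le> b" "b \<le> b'"
  shows "norm (poly (roots_poly (image_mset of_real L)) (Complex a b))
    \<le> norm (poly (roots_poly (image_mset of_real L)) (Complex a b'))"
  unfolding poly_roots_poly
proof (induction L)
  case (add l L)
  have "norm (Complex a b - of_real l) \<le> norm (Complex a b' - of_real l)"
    using assms by (simp add: cmod_def power_mono)
  with add show ?case by (simp add: norm_mult mult_mono)
qed simp

lemma real_rooted_limit:
  fixes q :: "complex poly" and p :: "nat \<Rightarrow> complex poly"
  assumes lim: "\<And>z. (\<lambda>k. poly (p k) z) \<longlonglongrightarrow> poly q z"
    and rr: "\<And>k z. poly (p k) z = 0 \<Longrightarrow> Im z = 0"
    and z: "poly q z = 0" "Im z > 0"
  shows "q = 0"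
proof -
  have mono: "norm (poly (p k) (Complex (Re z) b)) \<le> norm (poly (p k) z)" if "0 \<le> b" "b \<le> Im z" for k b
  proof -
    obtain L where L: "p k = smult (lead_coeff (p k)) (roots_poly L)" using complex_poly_roots_poly .
    have "p k \<noteq> 0" using rr[of k \<i>] by auto
    have "\<forall>l\<in>#L. l = of_real (Re l)"
    proof
      fix l assume "l \<in># L"
      then have "poly (p k) l = 0" using L by (metis mult_zero_right poly_roots_poly_eq_0_iff poly_smult)
      then show "l = of_real (Re l)" using rr by (simp add: complex_eq_iff)
    qed
    then have "L = image_mset of_real (image_mset Re L)" by (induction L) auto
    then show ?thesis using norm_roots_poly_mono[OF that, of "image_mset Re L" "Re z"]
      by (subst L, subst (2) L) (simp add: norm_mult mult_left_mono)
  qed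
  have "poly q (Complex (Re z) b) = 0" if "0 \<le> b" "b \<le> Im z" for b
  proof -
    have "(\<lambda>k. norm (poly (p k) z)) \<longlonglongrightarrow> 0" using tendsto_norm[OF lim[of z]] z by simp
    then have "(\<lambda>k. poly (p k) (Complex (Re z) b)) \<longlonglongrightarrow> 0"
      by (rule Lim_null_comparison[rotated]) (simp add: mono that)
    then show ?thesis using lim LIMSEQ_unique by blast
  qed
  then have "Complex (Re z) ` {0..Im z} \<subseteq> {w. poly q w = 0}" by auto
  moreover have "infinite (Complex (Re z) ` {0..Im z})"
    using z(2) by (subst finite_image_iff) (auto intro: inj_onI)
  ultimately show "q = 0" using poly_roots_finite infinite_super by blast
qed

subsection \<open>Polynomial functions and their complex extension\<close>

definition cvec :: "real ^ 'n \<Rightarrow> complex ^ 'n" where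
  "cvec x = (\<chi> i. complex_of_real (x $ i))"

lemma cvec_nth [simp]: "cvec x $ i = of_real (x $ i)"
  by (simp add: cvec_def)

lemma cvec_simps:
  "cvec 0 = 0" "cvec (x + y) = cvec x + cvec y" "cvec (x - y) = cvec x - cvec y"
  "cvec (- x) = - cvec x" "cvec (a *\<^sub>R x) = complex_of_real a *s cvec x"
  by (simp_all add: vec_eq_iff)

text \<open>\<open>poly_fun k g G T\<close>: \<open>g\<close> is a real polynomial function of degree at most \<open>k\<close>, \<open>G\<close> its extension
  to complex arguments, and \<open>T\<close> its (possibly vanishing) homogeneous part of degree \<open>k\<close>.\<close>

inductive poly_fun ::
    "nat \<Rightarrow> (real ^ 'n \<Rightarrow> real) \<Rightarrow> (complex ^ 'n \<Rightarrow> complex) \<Rightarrow> (complex ^ 'n \<Rightarrow> complex) \<Rightarrow> bool" where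
  const: "poly_fun 0 (\<lambda>_. a) (\<lambda>_. of_real a) (\<lambda>_. of_real a)"
| lower: "poly_fun k g G T \<Longrightarrow> poly_fun (Suc k) g G (\<lambda>_. 0)"
| add: "poly_fun k g G T \<Longrightarrow> poly_fun k g' G' T' \<Longrightarrow>
    poly_fun k (\<lambda>x. g x + g' x) (\<lambda>z. G z + G' z) (\<lambda>z. T z + T' z)"
| coord: "poly_fun k g G T \<Longrightarrow>
    poly_fun (Suc k) (\<lambda>x. x $ i * g x) (\<lambda>z. z $ i * G z) (\<lambda>z. z $ i * T z)"

lemma poly_fun_cvec: "poly_fun k g G T \<Longrightarrow> G (cvec x) = of_real (g x)"
  by (induction rule: poly_fun.induct) auto

text \<open>The coefficients are real. Hence nonreal zeros on real lines come in conjugate pairs,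
  and one half plane suffices later.\<close>

lemma poly_fun_cnj: "poly_fun k g G T \<Longrightarrow> G (\<chi> i. cnj (z $ i)) = cnj (G z)"
  by (induction rule: poly_fun.induct) auto

lemma poly_fun_zero: "poly_fun k (\<lambda>_. 0) (\<lambda>_. 0) (\<lambda>_. 0)"
  by (induction k) (use const[of 0] lower in auto)

lemma poly_fun_scale:
  "poly_fun k g G T \<Longrightarrow> poly_fun k (\<lambda>x. a * g x) (\<lambda>z. of_real a * G z) (\<lambda>z. of_real a * T z)"
proof (induction rule: poly_fun.induct)
  case (const b)
  then show ?case using poly_fun.const[of "a * b"] by simp
next
  case (lower k g G T)
  then show ?case using poly_fun.lower by fastforce
next
  case (add k g G T g' G' T')
  then show ?case using poly_fun.add[OF add.IH] by (simp add: distrib_left)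
next
  case (coord k g G T i)
  then show ?case using poly_fun.coord[OF coord.IH, of i] by (simp add: mult.left_commute)
qed

lemma poly_fun_sum:
  assumes "finite A" "\<And>a. a \<in> A \<Longrightarrow> poly_fun k (g a) (G a) (T a)"
  shows "poly_fun k (\<lambda>x. \<Sum>a\<in>A. g a x) (\<lambda>z. \<Sum>a\<in>A. G a z) (\<lambda>z. \<Sum>a\<in>A. T a z)"
  using assms by (induction A rule: finite_induct) (auto intro: poly_fun_zero poly_fun.add)

lemma poly_fun_coord_power:
  assumes "poly_fun k g G T"
  shows "poly_fun (a + k) (\<lambda>x. (x $ i) ^ a * g x) (\<lambda>z. (z $ i) ^ a * G z) (\<lambda>z. (z $ i) ^ a * T z)"
proof (induction a)
  case (Suc a)
  show ?case using poly_fun.coord[OF Suc, of i] by (simp add: mult.assoc)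
qed (use assms in simp)

lemma poly_fun_monomial:
  fixes \<alpha> :: "'n::finite \<Rightarrow> nat"
  assumes "finite I"
  shows "poly_fun (\<Sum>i\<in>I. \<alpha> i) (\<lambda>x. \<Prod>i\<in>I. (x $ i) ^ \<alpha> i)
    (\<lambda>z. \<Prod>i\<in>I. (z $ i) ^ \<alpha> i) (\<lambda>z. \<Prod>i\<in>I. (z $ i) ^ \<alpha> i)"
  using assms
proof (induction I rule: finite_induct)
  case empty
  then show ?case using poly_fun.const[of 1] by simp
next
  case (insert i I)
  then show ?case using poly_fun_coord_power[OF insert.IH, of "\<alpha> i" i] by simp
qed

lemma finite_exponents: "finite {\<alpha> :: 'n::finite \<Rightarrow> nat. (\<Sum>i\<in>UNIV. \<alpha> i) = d}"
proof (rule finite_subset)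
  show "{\<alpha> :: 'n \<Rightarrow> nat. (\<Sum>i\<in>UNIV. \<alpha> i) = d} \<subseteq> Pi\<^sub>E UNIV (\<lambda>_. {..d})"
    by (auto simp: member_le_sum)
  show "finite (Pi\<^sub>E UNIV (\<lambda>_. {..d}) :: ('n \<Rightarrow> nat) set)"
    by (intro finite_PiE) auto
qed

text \<open>A homogeneous polynomial is its own top part, hence \<open>H\<close> in both places. The
  scaling law is needed for complex scalars such as \<open>\<i>\<close>.\<close>

lemma homogeneous_polynomial_poly_fun:
  assumes "homogeneous_polynomial d h"
  obtains H where "poly_fun d h H H" "\<And>w z. H (w *s z) = w ^ d * H z"
proof -
  obtain c where c: "\<And>x. h x = (\<Sum>\<alpha> | (\<Sum>i\<in>UNIV. \<alpha> i) = d. c \<alpha> * (\<Prod>i\<in>UNIV. (x $ i) ^ \<alpha> i))"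
    using assms unfolding homogeneous_polynomial_def by blast
  define H :: "complex ^ 'a \<Rightarrow> complex" where
    "H z = (\<Sum>\<alpha> | (\<Sum>i\<in>UNIV. \<alpha> i) = d. of_real (c \<alpha>) * (\<Prod>i\<in>UNIV. (z $ i) ^ \<alpha> i))" for z
  have "poly_fun d (\<lambda>x. \<Sum>\<alpha> | (\<Sum>i\<in>UNIV. \<alpha> i) = d. c \<alpha> * (\<Prod>i\<in>UNIV. (x $ i) ^ \<alpha> i)) H H"
    unfolding H_def[abs_def]
    by (intro poly_fun_sum finite_exponents poly_fun_scale) (use poly_fun_monomial[of UNIV] in auto)
  moreover have "H (w *s z) = w ^ d * H z" for w z
    unfolding H_def sum_distrib_left
    by (intro sum.cong refl) (auto simp: power_mult_distrib prod.distrib power_sum[symmetric])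
  moreover have "h = (\<lambda>x. \<Sum>\<alpha> | (\<Sum>i\<in>UNIV. \<alpha> i) = d. c \<alpha> * (\<Prod>i\<in>UNIV. (x $ i) ^ \<alpha> i))"
    using c by blast
  ultimately show ?thesis using that by simp
qed

text \<open>The form required for following zeros along moving lines: coefficients depend
  continuously on base point and direction, and the coefficient of degree \<open>k\<close> on the
  direction only.\<close>

lemma poly_fun_line:
  assumes "poly_fun k g G T"
  shows "\<exists>q. (\<forall>a u z. G (a + z *s u) = poly (q (a, u)) z) \<and> (\<forall>x. degree (q x) \<le> k) \<and>
    (\<forall>a u. coeff (q (a, u)) k = T u) \<and> (\<forall>j. continuous_on UNIV (\<lambda>x. coeff (q x) j))"
  using assms
proof (induction rule: poly_fun.induct)
  case (const a)
  show ?case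
    by (intro exI[of _ "\<lambda>_. [:of_real a:]"]) (auto intro!: continuous_intros)
next
  case (lower k g G T)
  then obtain q where "(\<forall>a u z. G (a + z *s u) = poly (q (a, u)) z)" "(\<forall>x. degree (q x) \<le> k)"
    "(\<forall>j. continuous_on UNIV (\<lambda>x. coeff (q x) j))" by blast
  then show ?case by (intro exI[of _ q]) (auto simp: coeff_eq_0 le_SucI le_imp_less_Suc)
next
  case (add k g G T g' G' T')
  then obtain q q' where "(\<forall>a u z. G (a + z *s u) = poly (q (a, u)) z)" "(\<forall>x. degree (q x) \<le> k)"
    "(\<forall>a u. coeff (q (a, u)) k = T u)" "(\<forall>j. continuous_on UNIV (\<lambda>x. coeff (q x) j))"
    "(\<forall>a u z. G' (a + z *s u) = poly (q' (a, u)) z)" "(\<forall>x. degree (q' x) \<le> k)"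
    "(\<forall>a u. coeff (q' (a, u)) k = T' u)" "(\<forall>j. continuous_on UNIV (\<lambda>x. coeff (q' x) j))" by blast
  then show ?case
    by (intro exI[of _ "\<lambda>x. q x + q' x"]) (auto intro!: continuous_intros degree_add_le)
next
  case (coord k g G T i)
  then obtain q where q: "(\<forall>a u z. G (a + z *s u) = poly (q (a, u)) z)" "(\<forall>x. degree (q x) \<le> k)"
    "(\<forall>a u. coeff (q (a, u)) k = T u)" "(\<forall>j. continuous_on UNIV (\<lambda>x. coeff (q x) j))" by blast
  let ?q = "\<lambda>x. smult (fst x $ i) (q x) + pCons 0 (smult (snd x $ i) (q x))"
  have c: "continuous_on UNIV (\<lambda>x. coeff (?q x) j)" for j
    by (cases j) (auto intro!: continuous_intros q(4)[rule_format])
  have "degree (pCons 0 (smult a (q x))) \<le> Suc k" for a x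
    using q(2) by (metis Suc_le_mono degree_pCons_le degree_smult_le le_trans)
  then have d: "degree (?q x) \<le> Suc k" for x
    using q(2) by (intro degree_add_le) (metis degree_smult_le le_SucI le_trans, blast)
  show ?case
    using q c d by (intro exI[of _ ?q]) (auto simp: algebra_simps coeff_eq_0 le_imp_less_Suc)
qed

text \<open>One induction builds the real restriction and its complex extension together with their
  derivatives, so that knowledge of complex zeros carries over to \<open>q\<close>.\<close>

lemma poly_fun_real_line:
  assumes "poly_fun k g G T"
  shows "\<exists>q qc. (\<forall>s. g (x + s *\<^sub>R u) = poly q s) \<and> (\<forall>z. G (cvec x + z *s cvec u) = poly qc z) \<and>
    (\<forall>s. poly qc (of_real s) = of_real (poly q s)) \<and>
    (\<forall>s. poly (pderiv qc) (of_real s) = of_real (poly (pderiv q) s)) \<and>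
    degree q \<le> k \<and> of_real (coeff q k) = T (cvec u)"
  using assms
proof (induction rule: poly_fun.induct)
  case (const a)
  show ?case by (intro exI[of _ "[:a:]"] exI[of _ "[:of_real a:]"]) (auto simp: pderiv_pCons)
next
  case (lower k g G T)
  then obtain q qc where "(\<forall>s. g (x + s *\<^sub>R u) = poly q s)" "(\<forall>z. G (cvec x + z *s cvec u) = poly qc z)"
    "(\<forall>s. poly qc (of_real s) = of_real (poly q s))"
    "(\<forall>s. poly (pderiv qc) (of_real s) = of_real (poly (pderiv q) s))"
    "degree q \<le> k" by blast
  then show ?case by (intro exI[of _ q] exI[of _ qc]) (auto simp: coeff_eq_0)
next
  case (add k g G T g' G' T')
  then obtain q qc q' qc' where "(\<forall>s. g (x + s *\<^sub>R u) = poly q s)" "(\<forall>z. G (cvec x + z *s cvec u) = poly qc z)"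
    "(\<forall>s. poly qc (of_real s) = of_real (poly q s))"
    "(\<forall>s. poly (pderiv qc) (of_real s) = of_real (poly (pderiv q) s))"
    "degree q \<le> k" "of_real (coeff q k) = T (cvec u)"
    "(\<forall>s. g' (x + s *\<^sub>R u) = poly q' s)" "(\<forall>z. G' (cvec x + z *s cvec u) = poly qc' z)"
    "(\<forall>s. poly qc' (of_real s) = of_real (poly q' s))"
    "(\<forall>s. poly (pderiv qc') (of_real s) = of_real (poly (pderiv q') s))"
    "degree q' \<le> k" "of_real (coeff q' k) = T' (cvec u)" by blast
  then show ?case
    by (intro exI[of _ "q + q'"] exI[of _ "qc + qc'"]) (auto simp: pderiv_add degree_add_le)
next
  case (coord k g G T i)
  then obtain q qc where q: "(\<forall>s. g (x + s *\<^sub>R u) = poly q s)" "(\<forall>z. G (cvec x + z *s cvec u) = poly qc z)"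
    "(\<forall>s. poly qc (of_real s) = of_real (poly q s))"
    "(\<forall>s. poly (pderiv qc) (of_real s) = of_real (poly (pderiv q) s))"
    "degree q \<le> k" "of_real (coeff q k) = T (cvec u)" by blast
  let ?q = "[:x $ i, u $ i:] * q" and ?qc = "[:of_real (x $ i), of_real (u $ i):] * qc"
  have "degree ?q \<le> Suc k"
    using degree_mult_le[of "[:x $ i, u $ i:]" q] q(5) by (auto split: if_splits)
  moreover have "poly (pderiv ?qc) (of_real s) = of_real (poly (pderiv ?q) s)" for s
    using q(3,4) by (simp only: pderiv_mult) (simp add: pderiv_pCons)
  ultimately show ?case
    using q
    by (intro exI[of _ ?q] exI[of _ ?qc]) (auto simp: algebra_simps coeff_eq_0)
qed

section \<open>Directional derivatives of polynomial functions\<close>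

lemma partial_deriv_eqI:
  "((\<lambda>s. g (x + s *\<^sub>R axis i 1)) has_real_derivative D) (at 0) \<Longrightarrow> partial_deriv i g x = D"
  unfolding partial_deriv_def by (rule DERIV_imp_deriv)

text \<open>\<open>deriv\<close> is meaningful only where a derivative exists; here it does, because
  the restriction to a line is a univariate polynomial.\<close>

lemma poly_fun_partial_deriv:
  assumes "poly_fun k g G T"
  shows "((\<lambda>s. g (x + s *\<^sub>R axis i 1)) has_real_derivative partial_deriv i g x) (at 0)"
proof -
  obtain q where "\<And>s. g (x + s *\<^sub>R axis i 1) = poly q s"
    using poly_fun_real_line[OF assms] by blast
  then have "((\<lambda>s. g (x + s *\<^sub>R axis i 1)) has_real_derivative poly (pderiv q) 0) (at 0)"
    by (auto intro!: derivative_eq_intros)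
  then show ?thesis using partial_deriv_eqI by metis
qed

lemma dir_deriv_add:
  assumes "poly_fun k g G T" "poly_fun k' g' G' T'"
  shows "dir_deriv v (\<lambda>x. g x + g' x) x = dir_deriv v g x + dir_deriv v g' x"
proof -
  have "partial_deriv i (\<lambda>x. g x + g' x) x = partial_deriv i g x + partial_deriv i g' x" for i
    by (intro partial_deriv_eqI) (auto intro!: derivative_eq_intros poly_fun_partial_deriv assms)
  then show ?thesis unfolding dir_deriv_def by (simp add: sum.distrib algebra_simps)
qed

lemma dir_deriv_coord:
  assumes "poly_fun k g G T"
  shows "dir_deriv v (\<lambda>x. x $ i * g x) x = v $ i * g x + x $ i * dir_deriv v g x"
proof -
  have "partial_deriv j (\<lambda>x. x $ i * g x) x = (if i = j then g x else 0) + x $ i * partial_deriv j g x" for j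
  proof (rule partial_deriv_eqI)
    have "((\<lambda>s. (x + s *\<^sub>R axis j 1) $ i) has_real_derivative (if i = j then 1 else 0)) (at 0)"
      by (cases "i = j") (auto simp: axis_def intro!: derivative_eq_intros)
    from DERIV_mult[OF this poly_fun_partial_deriv[OF assms]]
    show "((\<lambda>s. (x + s *\<^sub>R axis j 1) $ i * g (x + s *\<^sub>R axis j 1)) has_real_derivative
        (if i = j then g x else 0) + x $ i * partial_deriv j g x) (at 0)"
      by (auto simp: algebra_simps)
  qed
  then have "dir_deriv v (\<lambda>x. x $ i * g x) x
      = (\<Sum>j\<in>UNIV. (if i = j then v $ j * g x else 0) + x $ i * (v $ j * partial_deriv j g x))"
    unfolding dir_deriv_def by (intro sum.cong refl) (auto simp: algebra_simps)
  then show ?thesis unfolding dir_deriv_def by (simp add: sum.distrib sum_distrib_left)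
qed

text \<open>The bound \<open>k\<close> is kept with top part 0, so subtracting a multiple of the
  derivative preserves the top part of \<open>g\<close>. Describing \<open>G'\<close> as a complex
  derivative along \<open>v\<close> permits univariate arguments on complex lines.\<close>

lemma poly_fun_dir_deriv:
  assumes "poly_fun k g G T"
  shows "\<exists>G'. poly_fun k (dir_deriv v g) G' (\<lambda>_. 0) \<and>
    (\<forall>z. ((\<lambda>s. G (z + s *s cvec v)) has_field_derivative G' z) (at 0))"
  using assms
proof (induction rule: poly_fun.induct)
  case (const a)
  have "dir_deriv v (\<lambda>_. a) = (\<lambda>_. 0)"
    by (auto simp: dir_deriv_def partial_deriv_def)
  then show ?case using poly_fun_zero by (intro exI[of _ "\<lambda>_. 0"]) auto
next
  case (lower k g G T)
  then show ?case using poly_fun.lower by blast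
next
  case (add k g G T g' G' T')
  then obtain D D' where D: "poly_fun k (dir_deriv v g) D (\<lambda>_. 0)"
      "\<forall>z. ((\<lambda>s. G (z + s *s cvec v)) has_field_derivative D z) (at 0)"
      "poly_fun k (dir_deriv v g') D' (\<lambda>_. 0)"
      "\<forall>z. ((\<lambda>s. G' (z + s *s cvec v)) has_field_derivative D' z) (at 0)" by blast
  have "dir_deriv v (\<lambda>x. g x + g' x) = (\<lambda>x. dir_deriv v g x + dir_deriv v g' x)"
    using dir_deriv_add[OF add.hyps] by auto
  then show ?case using D poly_fun.add[OF D(1,3)]
    by (intro exI[of _ "\<lambda>z. D z + D' z"]) (auto intro!: derivative_eq_intros)
next
  case (coord k g G T i)
  then obtain D where D: "poly_fun k (dir_deriv v g) D (\<lambda>_. 0)"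
      "\<forall>z. ((\<lambda>s. G (z + s *s cvec v)) has_field_derivative D z) (at 0)" by blast
  have "dir_deriv v (\<lambda>x. x $ i * g x) = (\<lambda>x. v $ i * g x + x $ i * dir_deriv v g x)"
    using dir_deriv_coord[OF coord.hyps] by auto
  moreover have "poly_fun (Suc k) (\<lambda>x. v $ i * g x + x $ i * dir_deriv v g x)
      (\<lambda>z. of_real (v $ i) * G z + z $ i * D z) (\<lambda>_. 0)"
    using poly_fun.add[OF poly_fun.lower[OF poly_fun_scale[OF coord.hyps, of "v $ i"]] poly_fun.coord[OF D(1), of i]]
    by simp
  moreover have "((\<lambda>s. (z + s *s cvec v) $ i * G (z + s *s cvec v)) has_field_derivative
      of_real (v $ i) * G z + z $ i * D z) (at 0)" for z
    by (auto intro!: derivative_eq_intros D(2)[rule_format])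
  ultimately show ?case by (intro exI[of _ "\<lambda>z. of_real (v $ i) * G z + z $ i * D z"]) auto
qed

subsection \<open>Hyperbolicity cone and stability\<close>

lemma poly_fun_continuous: "poly_fun k g G T \<Longrightarrow> continuous_on UNIV G"
  by (induction rule: poly_fun.induct) (auto intro!: continuous_intros)

lemma continuous_on_of_real_smult:
  fixes z :: "complex ^ 'n"
  assumes "continuous_on S f"
  shows "continuous_on S (\<lambda>x. complex_of_real (f x) *s z)"
  unfolding vector_scalar_mult_def by (intro continuous_on_vec_lambda continuous_intros assms)

lemma cvec_line: "cvec x + z *s cvec u = cvec (x + Re z *\<^sub>R u) + \<i> *s cvec (Im z *\<^sub>R u)"
  by (simp add: vec_eq_iff complex_eq_iff)

lemma frontier_halfplanes:
  "z \<in> frontier {z. Im z > 0} \<Longrightarrow> Im z = 0" "z \<in> frontier {z. Re z > 0} \<Longrightarrow> Re z = 0"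
proof -
  have "closure {z. Im z > 0} \<subseteq> {z. Im z \<ge> 0}" "closure {z. Re z > 0} \<subseteq> {z. Re z \<ge> 0}"
    by (rule closure_minimal; auto simp: closed_halfspace_Im_ge closed_halfspace_Re_ge)+
  then show "z \<in> frontier {z. Im z > 0} \<Longrightarrow> Im z = 0" "z \<in> frontier {z. Re z > 0} \<Longrightarrow> Re z = 0"
    by (fastforce simp: frontier_def interior_open open_halfspace_Im_gt open_halfspace_Re_gt)+
qed

text \<open>Hyperbolicity in terms of the complex extension; \<open>h e \<noteq> 0\<close> follows
  with \<open>x = 0\<close> and \<open>w = \<i>\<close>. The assumptions survive replacing
  \<open>e\<close> by \<open>- e\<close>.\<close>

locale hyperbolic_form =
  fixes d :: nat and h :: "real ^ 'n \<Rightarrow> real" and H :: "complex ^ 'n \<Rightarrow> complex" and e :: "real ^ 'n"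
  assumes pf: "poly_fun d h H H"
    and hom: "H (w *s z) = w ^ d * H z"
    and hyp: "Im w \<noteq> 0 \<Longrightarrow> H (cvec x + w *s cvec e) \<noteq> 0"
begin

lemma H_cvec: "H (cvec x) = of_real (h x)"
  using poly_fun_cvec[OF pf] .

lemma h_scale: "h (a *\<^sub>R x) = a ^ d * h x"
  using hom[of "of_real a" "cvec x"] H_cvec by (metis cvec_simps(5) of_real_eq_iff of_real_mult of_real_power)

lemma h_e: "h e \<noteq> 0"
  using hyp[of \<i> 0] hom[of \<i> "cvec e"] by (auto simp: cvec_simps H_cvec)

text \<open>\<open>Lam\<close> contains the closed hyperbolicity cone. For \<open>B\<close> only \<open>B + Lam \<subseteq> B\<close> is needed, not convexity.\<close>

definition Lam :: "(real ^ 'n) set" where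
  "Lam = {v. \<forall>t>0. h (v + t *\<^sub>R e) \<noteq> 0}"

definition B :: "(real ^ 'n) set" where
  "B = {y. \<forall>\<alpha>>0. \<forall>x. H (cvec x + \<i> *s cvec (y + \<alpha> *\<^sub>R e)) \<noteq> 0}"

lemma Lam_scale:
  assumes "v \<in> Lam" "\<beta> \<ge> 0"
  shows "\<beta> *\<^sub>R v \<in> Lam"
proof (cases "\<beta> = 0")
  case True
  then show ?thesis using h_scale[of _ e] h_e by (auto simp: Lam_def)
next
  case False
  then have b: "\<beta> > 0" using assms by simp
  have "h (\<beta> *\<^sub>R v + t *\<^sub>R e) \<noteq> 0" if "t > 0" for t
  proof -
    have "\<beta> *\<^sub>R v + t *\<^sub>R e = \<beta> *\<^sub>R (v + (t / \<beta>) *\<^sub>R e)" using b by (simp add: scaleR_add_right)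
    then show ?thesis using assms b that by (simp add: h_scale Lam_def)
  qed
  then show ?thesis by (simp add: Lam_def)
qed

lemma B_zero: "0 \<in> B"
  using hyp by (auto simp: B_def cvec_simps vector_smult_assoc)

lemma B_scale:
  assumes "y \<in> B" "\<beta> \<ge> 0"
  shows "\<beta> *\<^sub>R y \<in> B"
proof (cases "\<beta> = 0")
  case False
  then have b: "\<beta> > 0" using assms by simp
  have "H (cvec x + \<i> *s cvec (\<beta> *\<^sub>R y + \<alpha> *\<^sub>R e)) \<noteq> 0" if "\<alpha> > 0" for \<alpha> x
  proof -
    have eq: "cvec x + \<i> *s cvec (\<beta> *\<^sub>R y + \<alpha> *\<^sub>R e)
      = of_real \<beta> *s (cvec (x /\<^sub>R \<beta>) + \<i> *s cvec (y + (\<alpha> / \<beta>) *\<^sub>R e))"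
      using b by (simp add: vec_eq_iff field_simps)
    show ?thesis unfolding eq hom using assms b that by (simp add: B_def)
  qed
  then show ?thesis by (simp add: B_def)
qed (simp add: B_zero)

text \<open>Garding's argument: for \<open>v\<close> in the open cone the zeros \<open>z\<close> of $H(w + z v)$ stay in
  the lower half plane while \<open>w\<close> moves from $i a e$ to an arbitrary point of the tube.\<close>

lemma B_add:
  assumes y: "y \<in> B" and v: "v \<in> Lam"
  shows "y + v \<in> B"
  unfolding B_def mem_Collect_eq
proof (intro allI impI)
  fix \<alpha> :: real and x assume "\<alpha> > 0"
  \<comment> \<open>One half of \<alpha> moves \<open>v\<close> into the open cone, the other half
    keeps the path inside the tube.\<close>
  define a where "a = \<alpha> / 2"
  have a: "a > 0" using \<open>\<alpha> > 0\<close> by (simp add: a_def)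
  define v' where "v' = v + a *\<^sub>R e"
  define z0 where "z0 = cvec x + \<i> *s cvec y"
  define z1 where "z1 = \<i> *s cvec (a *\<^sub>R e)"
  obtain q where q: "\<And>a u z. H (a + z *s u) = poly (q (a, u)) z" "\<And>x. degree (q x) \<le> d"
    "\<And>a u. coeff (q (a, u)) d = H u" "\<And>j. continuous_on UNIV (\<lambda>x. coeff (q x) j)"
    using poly_fun_line[OF pf] by blast
  define P where "P \<theta> = q (complex_of_real \<theta> *s z0 + z1, cvec v')" for \<theta>
  have "poly (P 1) \<i> \<noteq> 0"
  proof (rule no_roots_continuation)
    show "degree (P \<theta>) \<le> d" for \<theta> unfolding P_def by (rule q(2))
    show "coeff (P \<theta>) d \<noteq> 0" for \<theta>
      unfolding P_def q(3) H_cvec v'_def using v a by (simp add: Lam_def)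
    show "continuous_on {0..1} (\<lambda>\<theta>. coeff (P \<theta>) j)" for j
      unfolding P_def
      by (intro continuous_on_compose2[OF q(4)] continuous_intros continuous_on_of_real_smult) auto
    show "open {z. Im z > 0}" by (rule open_halfspace_Im_gt)
    show "\<i> \<in> {z. Im z > 0}" by simp
    \<comment> \<open>For real \<open>z\<close> the term \<open>z v'\<close> changes only the real
      part, and the imaginary part \<open>\<theta> y + a e\<close> is admissible because
      \<open>\<theta> y\<close> is in \<open>B\<close>.\<close>
    show "poly (P \<theta>) z \<noteq> 0" if "\<theta> \<in> {0..1}" "z \<in> frontier {z. Im z > 0}" for \<theta> z
    proof -
      have "of_real \<theta> *s z0 + z1 + z *s cvec v'
        = cvec (\<theta> *\<^sub>R x + Re z *\<^sub>R v') + \<i> *s cvec (\<theta> *\<^sub>R y + a *\<^sub>R e)"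
        using frontier_halfplanes(1)[OF that(2)]
        by (simp add: z0_def z1_def vec_eq_iff complex_eq_iff algebra_simps)
      then show ?thesis
        using B_scale[OF y, of \<theta>] that(1) a by (simp add: P_def q(1)[symmetric] B_def)
    qed
    show "poly (P 0) z \<noteq> 0" if "z \<in> {z. Im z > 0}" for z
    proof -
      have z: "Im z > 0" "z \<noteq> 0" using that by auto
      \<comment> \<open>Factoring out \<open>z\<close> leaves \<open>v' + \<tau> e\<close>, by
        homogeneity. A nonreal \<tau> is covered by hyperbolicity; a real one is positive and
        covered by \<open>v \<in> Lam\<close>.\<close>
      define \<tau> where "\<tau> = \<i> * of_real a / z"
      have zt: "z * \<tau> = \<i> * of_real a" using z by (simp add: \<tau>_def)
      have eq: "z1 + z *s cvec v' = z *s (cvec v' + \<tau> *s cvec e)"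
        using zt by (simp add: z1_def vec_eq_iff distrib_left mult.assoc[symmetric])
      have "H (cvec v' + \<tau> *s cvec e) \<noteq> 0"
      proof (cases "Im \<tau> = 0")
        case True
        have "a = Im (z * \<tau>)" unfolding zt by simp
        then have "a = Im z * Re \<tau>" using True by simp
        then have "Re \<tau> > 0" using a z by (metis zero_less_mult_pos)
        moreover have "cvec v' + \<tau> *s cvec e = cvec (v + (a + Re \<tau>) *\<^sub>R e)"
          using True by (simp add: v'_def vec_eq_iff complex_eq_iff algebra_simps)
        ultimately show ?thesis using v a by (simp add: H_cvec Lam_def)
      qed (rule hyp)
      then have "H (z1 + z *s cvec v') \<noteq> 0" unfolding eq hom using z by simp
      then show ?thesis by (simp add: P_def q(1)[symmetric])
    qed
  qed
  moreover have "z0 + z1 + \<i> *s cvec v' = cvec x + \<i> *s cvec (y + v + \<alpha> *\<^sub>R e)"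
    by (simp add: z0_def z1_def v'_def a_def vec_eq_iff algebra_simps)
  ultimately show "H (cvec x + \<i> *s cvec (y + v + \<alpha> *\<^sub>R e)) \<noteq> 0"
    by (simp add: P_def q(1)[symmetric])
qed

text \<open>The strictly positive multiple of \<open>e\<close> turns the limiting condition in
  \<open>B\<close> into nonvanishing of \<open>H\<close> on the tube over the point itself.\<close>

definition C :: "(real ^ 'n) set" where
  "C = {y + a *\<^sub>R e | y a. y \<in> B \<and> a > 0}"

lemma C_scale:
  assumes "y \<in> C" "\<beta> > 0"
  shows "\<beta> *\<^sub>R y \<in> C"
proof -
  obtain b a where "y = b + a *\<^sub>R e" "b \<in> B" "a > 0" using assms unfolding C_def by blast
  then have "\<beta> *\<^sub>R y = \<beta> *\<^sub>R b + (\<beta> * a) *\<^sub>R e" "\<beta> *\<^sub>R b \<in> B" "\<beta> * a > 0"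
    using B_scale assms by (auto simp: scaleR_add_right)
  then show ?thesis unfolding C_def by blast
qed

lemma C_add:
  assumes "y \<in> C" "w \<in> Lam" "\<beta> \<ge> 0"
  shows "y + \<beta> *\<^sub>R w \<in> C"
proof -
  obtain b a where "y = b + a *\<^sub>R e" "b \<in> B" "a > 0" using assms unfolding C_def by blast
  then have "y + \<beta> *\<^sub>R w = (b + \<beta> *\<^sub>R w) + a *\<^sub>R e" "b + \<beta> *\<^sub>R w \<in> B" "a > 0"
    using B_add Lam_scale assms by auto
  then show ?thesis unfolding C_def by blast
qed

lemma C_comb: "a > 0 \<Longrightarrow> w \<in> Lam \<Longrightarrow> b \<ge> 0 \<Longrightarrow> a *\<^sub>R e + b *\<^sub>R w \<in> C"
  by (rule C_add) (use B_zero in \<open>force simp: C_def\<close>)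

text \<open>With the top part fixed as \<open>H\<close>, the leading coefficient along any direction
  \<open>u\<close> in \<open>C\<close> is \<open>H (cvec u)\<close>, which is nonzero; so the degree
  stays \<open>d\<close> while directions move in \<open>C\<close>.\<close>

definition stable :: "(real ^ 'n \<Rightarrow> real) \<Rightarrow> (complex ^ 'n \<Rightarrow> complex) \<Rightarrow> bool" where
  "stable g G \<longleftrightarrow> poly_fun d g G H \<and> (\<forall>x. \<forall>y\<in>C. G (cvec x + \<i> *s cvec y) \<noteq> 0)"

lemma stable_h: "stable h H"
  using pf by (auto simp: stable_def C_def B_def)

lemma H_C_nonzero: "u \<in> C \<Longrightarrow> H (cvec u) \<noteq> 0"
  using stable_h hom[of \<i> "cvec u"] unfolding stable_def by (metis add_0 cvec_simps(1) mult_zero_right)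

lemma stable_line_cnj:
  assumes "stable g G" "G (cvec x + z *s cvec u) = 0"
  shows "G (cvec x + cnj z *s cvec u) = 0"
proof -
  have "(\<chi> i. cnj ((cvec x + z *s cvec u) $ i)) = cvec x + cnj z *s cvec u" by (simp add: vec_eq_iff)
  then show ?thesis using assms poly_fun_cnj unfolding stable_def by (metis complex_cnj_zero)
qed

text \<open>For \<open>Im z > 0\<close> the imaginary part of \<open>x + z u\<close> is a positive
  multiple of \<open>u\<close>, hence in \<open>C\<close>; conjugation deals with
  \<open>Im z < 0\<close>.\<close>

lemma stable_real_rooted:
  assumes g: "stable g G" and u: "u \<in> C" and z: "G (cvec x + z *s cvec u) = 0"
  shows "Im z = 0"
proof (rule ccontr)
  have *: False if "Im z > 0" "G (cvec x + z *s cvec u) = 0" for z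
    using that(2) g C_scale[OF u that(1)] cvec_line[of x z u] by (auto simp: stable_def)
  assume "Im z \<noteq> 0"
  then have "Im z > 0 \<or> Im (cnj z) > 0" by auto
  then show False using *[OF _ z] *[OF _ stable_line_cnj[OF g z]] by blast
qed

text \<open>At a point \<open>z\<close> of the tube, \<open>G (z + r w)\<close> has no zero
  \<open>r\<close> with \<open>Im r \<ge> 0\<close>, since adding \<open>Im r\<close> times
  \<open>w\<close> stays in \<open>C\<close>. The univariate statement on
  \<open>p - \<epsilon> p'\<close> then applies at 0.\<close>

lemma stable_diff_dir_deriv:
  assumes g: "stable g G" and w: "w \<in> Lam"
  shows "\<exists>F. stable (\<lambda>x. g x - \<epsilon> * dir_deriv w g x) F"
proof -
  have gpf: "poly_fun d g G H" using g by (simp add: stable_def)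
  obtain G' where G': "poly_fun d (dir_deriv w g) G' (\<lambda>_. 0)"
    "\<And>z. ((\<lambda>s. G (z + s *s cvec w)) has_field_derivative G' z) (at 0)"
    using poly_fun_dir_deriv[OF gpf] by blast
  obtain q where q: "\<And>a u z. G (a + z *s u) = poly (q (a, u)) z"
    using poly_fun_line[OF gpf] by blast
  have "G z - of_real \<epsilon> * G' z \<noteq> 0" if z: "z = cvec x + \<i> *s cvec y" "y \<in> C" for x y z
  proof -
    let ?p = "q (z, cvec w)"
    have "((\<lambda>s. G (z + s *s cvec w)) has_field_derivative poly (pderiv ?p) 0) (at 0)"
      unfolding q by (rule poly_DERIV)
    then have "G' z = poly (pderiv ?p) 0" using G'(2) DERIV_unique by blast
    moreover have "G z = poly ?p 0" using q[of z 0 "cvec w"] by simp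
    moreover have "poly ?p r \<noteq> 0" if "Im r \<ge> 0" for r
    proof -
      have "z + r *s cvec w = cvec (x + Re r *\<^sub>R w) + \<i> *s cvec (y + Im r *\<^sub>R w)"
        by (simp add: z vec_eq_iff complex_eq_iff)
      then show ?thesis using g C_add[OF z(2) w that] unfolding stable_def q[symmetric] by simp
    qed
    ultimately show ?thesis using stable_poly_minus_pderiv[of ?p \<epsilon>] by simp
  qed
  then have "stable (\<lambda>x. g x - \<epsilon> * dir_deriv w g x) (\<lambda>z. G z - of_real \<epsilon> * G' z)"
    using poly_fun.add[OF gpf poly_fun_scale[OF G'(1), of "-\<epsilon>"]] by (simp add: stable_def)
  then show ?thesis by blast
qed

text \<open>The direction moves from \<open>e\<close> to \<open>a e + b w\<close> inside
  \<open>C\<close>. All zeros on the way are real, so one could enter the right half plane only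
  through 0, that is, only if \<open>g x = 0\<close>.\<close>

lemma stable_nonzero_comb:
  assumes g: "stable g G" and w: "w \<in> Lam" and nz: "\<And>r. r \<ge> 0 \<Longrightarrow> g (x + r *\<^sub>R e) \<noteq> 0"
    and ab: "a > 0" "b \<ge> 0"
  shows "g (x + (a *\<^sub>R e + b *\<^sub>R w)) \<noteq> 0"
proof -
  have gpf: "poly_fun d g G H" using g by (simp add: stable_def)
  obtain q where q: "\<And>a u z. G (a + z *s u) = poly (q (a, u)) z" "\<And>x. degree (q x) \<le> d"
    "\<And>a u. coeff (q (a, u)) d = H u" "\<And>j. continuous_on UNIV (\<lambda>x. coeff (q x) j)"
    using poly_fun_line[OF gpf] by blast
  let ?u = "a *\<^sub>R e + b *\<^sub>R w"
  define v where "v \<theta> = (1 - \<theta> + \<theta> * a) *\<^sub>R e + (\<theta> * b) *\<^sub>R w" for \<theta>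
  have v: "cvec (v \<theta>) = cvec e + complex_of_real \<theta> *s (cvec ?u - cvec e)" for \<theta>
    by (simp add: v_def vec_eq_iff algebra_simps)
  define P where "P \<theta> = q (cvec x, cvec (v \<theta>))" for \<theta>
  have vC: "v \<theta> \<in> C" if "\<theta> \<in> {0..1}" for \<theta>
  proof -
    have "1 - \<theta> + \<theta> * a > 0"
      using that ab by (cases "\<theta> = 0") (auto intro: add_nonneg_pos)
    then show ?thesis unfolding v_def using that ab w by (intro C_comb) auto
  qed
  have PG: "poly (P \<theta>) z = G (cvec x + z *s cvec (v \<theta>))" for \<theta> z
    by (simp add: P_def q(1))
  have "poly (P 1) 1 \<noteq> 0"
  proof (rule no_roots_continuation)
    show "degree (P \<theta>) \<le> d" for \<theta> unfolding P_def by (rule q(2))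
    show "coeff (P \<theta>) d \<noteq> 0" if "\<theta> \<in> {0..1}" for \<theta>
      unfolding P_def q(3) using H_C_nonzero vC[OF that] .
    show "continuous_on {0..1} (\<lambda>\<theta>. coeff (P \<theta>) j)" for j
      unfolding P_def v
      by (intro continuous_on_compose2[OF q(4)] continuous_intros continuous_on_of_real_smult) auto
    show "open {z. Re z > 0}" by (rule open_halfspace_Re_gt)
    show "1 \<in> {z. Re z > 0}" by simp
    show "poly (P \<theta>) z \<noteq> 0" if "\<theta> \<in> {0..1}" "z \<in> frontier {z. Re z > 0}" for \<theta> z
    proof
      assume 0: "poly (P \<theta>) z = 0"
      then have "Im z = 0" using stable_real_rooted[OF g vC[OF that(1)]] PG by metis
      then have "z = 0" using frontier_halfplanes(2)[OF that(2)] by (simp add: complex_eq_iff)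
      then have "G (cvec x) = 0" using 0 PG[of \<theta> z] by simp
      then show False using nz[of 0] poly_fun_cvec[OF gpf, of x] by simp
    qed
    show "poly (P 0) z \<noteq> 0" if "z \<in> {z. Re z > 0}" for z
    proof
      assume 0: "poly (P 0) z = 0"
      then have "Im z = 0" using stable_real_rooted[OF g vC[of 0]] PG by (metis atLeastAtMost_iff order_refl zero_le_one)
      then have "cvec x + z *s cvec (v 0) = cvec (x + Re z *\<^sub>R e)"
        by (simp add: v_def vec_eq_iff complex_eq_iff)
      then show False using 0 PG[of 0 z] nz[of "Re z"] that poly_fun_cvec[OF gpf] by simp
    qed
  qed
  moreover have "cvec x + 1 *s cvec (v 1) = cvec (x + ?u)" by (simp add: v_def vec_eq_iff)
  ultimately show ?thesis using PG[of 1 1] poly_fun_cvec[OF gpf] by simp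
qed

text \<open>As \<open>w\<close> may lie on the boundary of the cone, the argument starts at
  \<open>x - (\<delta>/2) e\<close>, by continuity still above all zeros; seen from there the
  displacement \<open>(\<delta>/2) e + s w\<close> has a positive share of \<open>e\<close>.\<close>

lemma stable_nonzero_translate:
  assumes g: "stable g G" and w: "w \<in> Lam" and nz: "\<And>r. r \<ge> 0 \<Longrightarrow> g (x + r *\<^sub>R e) \<noteq> 0" and s: "s \<ge> 0"
  shows "g (x + s *\<^sub>R w) \<noteq> 0"
proof -
  have gpf: "poly_fun d g G H" using g by (simp add: stable_def)
  obtain q where q: "\<And>r. g (x + r *\<^sub>R e) = poly q r"
    using poly_fun_real_line[OF gpf] by blast
  have "poly q 0 \<noteq> 0" using nz[of 0] q[of 0] by simp
  moreover have "isCont (poly q) 0" by simp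
  ultimately have "\<forall>\<^sub>F r in at 0. poly q r \<noteq> 0"
    unfolding isCont_def using tendsto_imp_eventually_ne by blast
  then obtain \<delta> where \<delta>: "\<delta> > 0" "\<And>r. r \<noteq> 0 \<Longrightarrow> dist r 0 < \<delta> \<Longrightarrow> poly q r \<noteq> 0"
    unfolding eventually_at by blast
  have "g ((x - (\<delta>/2) *\<^sub>R e) + r *\<^sub>R e) \<noteq> 0" if "r \<ge> 0" for r
  proof -
    have eq: "(x - (\<delta>/2) *\<^sub>R e) + r *\<^sub>R e = x + (r - \<delta>/2) *\<^sub>R e" by (simp add: algebra_simps)
    have "poly q (r - \<delta>/2) \<noteq> 0"
      using nz[of "r - \<delta>/2"] q[of "r - \<delta>/2"] \<delta> that by (cases "r - \<delta>/2 \<ge> 0") (auto simp: dist_real_def)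
    then show ?thesis unfolding eq q .
  qed
  from stable_nonzero_comb[OF g w this, of "\<delta>/2" s] \<delta>(1) s show ?thesis by simp
qed

text \<open>The directions \<open>w + e / (k + 1)\<close> lie in \<open>C\<close>, where
  restrictions are real-rooted; the limit along \<open>w\<close> is then real-rooted or zero. The
  zero polynomial has the stated form with leading coefficient 0.\<close>

lemma stable_line_Lam:
  assumes g: "stable g G" and w: "w \<in> Lam"
  obtains q L where "\<And>s. g (x + s *\<^sub>R w) = poly q s" "\<And>s. dir_deriv w g (x + s *\<^sub>R w) = poly (pderiv q) s"
    "q = smult (lead_coeff q) (roots_poly L)"
proof -
  have gpf: "poly_fun d g G H" using g by (simp add: stable_def)
  obtain G' where G': "poly_fun d (dir_deriv w g) G' (\<lambda>_. 0)"
    "\<And>z. ((\<lambda>s. G (z + s *s cvec w)) has_field_derivative G' z) (at 0)"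
    using poly_fun_dir_deriv[OF gpf] by blast
  obtain q qc where q: "\<And>s. g (x + s *\<^sub>R w) = poly q s" "\<And>z. G (cvec x + z *s cvec w) = poly qc z"
    "\<And>s. poly qc (of_real s) = of_real (poly q s)"
    "\<And>s. poly (pderiv qc) (of_real s) = of_real (poly (pderiv q) s)"
    using poly_fun_real_line[OF gpf] by blast
  \<comment> \<open>The sum of partial derivatives is matched with \<open>q'\<close> through the
    complex derivative of \<open>G\<close> along \<open>w\<close>, which is unique.\<close>
  have dd: "dir_deriv w g (x + s *\<^sub>R w) = poly (pderiv q) s" for s
  proof -
    have "((\<lambda>r. poly qc (of_real s + r)) has_field_derivative poly (pderiv qc) (of_real s + 0) * 1) (at 0)"
      by (rule DERIV_chain2[OF poly_DERIV]) (auto intro!: derivative_eq_intros)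
    moreover have "poly qc (of_real s + r) = G (cvec (x + s *\<^sub>R w) + r *s cvec w)" for r
      unfolding q(2)[symmetric] by (rule arg_cong[of _ _ G]) (simp add: vec_eq_iff algebra_simps)
    ultimately have "G' (cvec (x + s *\<^sub>R w)) = of_real (poly (pderiv q) s)"
      using DERIV_unique[OF G'(2)] q(4) by simp
    then show ?thesis using poly_fun_cvec[OF G'(1), of "x + s *\<^sub>R w"] by simp
  qed
  have "\<exists>L. q = smult (lead_coeff q) (roots_poly L)"
  proof (cases "qc = 0")
    case True
    then have "poly q s = 0" for s using q(3)[of s] by simp
    then have "q = 0" using poly_all_0_iff_0 by blast
    then show ?thesis by simp
  next
    case False
    obtain l where l: "\<And>a u z. G (a + z *s u) = poly (l (a, u)) z"
      using poly_fun_line[OF gpf] by blast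
    define u where "u k = inverse (real (Suc k)) *\<^sub>R e + 1 *\<^sub>R w" for k
    have uC: "u k \<in> C" for k unfolding u_def by (rule C_comb) (use w in auto)
    have nr: False if z: "poly qc z = 0" "Im z > 0" for z
    proof -
      have "qc = 0"
      proof (rule real_rooted_limit[OF _ _ z])
        show "Im z = 0" if "poly (l (cvec x, cvec (u k))) z = 0" for k z
          using that stable_real_rooted[OF g uC] l by metis
        fix z
        have "(\<lambda>k. complex_of_real (inverse (real (Suc k)))) \<longlonglongrightarrow> of_real 0"
          by (intro tendsto_of_real LIMSEQ_inverse_real_of_nat)
        then have "(\<lambda>k. cvec x + z *s cvec w + of_real (inverse (real (Suc k))) *s (z *s cvec e))
            \<longlonglongrightarrow> cvec x + z *s cvec w + of_real 0 *s (z *s cvec e)"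
          by (intro vec_tendstoI) (simp only: vector_add_component vector_smult_component, intro tendsto_intros LIMSEQ_inverse_real_of_nat)
        moreover have "isCont G y" for y
          using poly_fun_continuous[OF gpf] by (simp add: continuous_on_eq_continuous_at)
        ultimately have "(\<lambda>k. G (cvec x + z *s cvec w + of_real (inverse (real (Suc k))) *s (z *s cvec e)))
            \<longlonglongrightarrow> G (cvec x + z *s cvec w + of_real 0 *s (z *s cvec e))"
          using isCont_tendsto_compose by blast
        moreover have eq: "cvec x + z *s cvec w + of_real (inverse (real (Suc k))) *s (z *s cvec e)
            = cvec x + z *s cvec (u k)" for k
          by (simp add: u_def vec_eq_iff algebra_simps)
        ultimately have "(\<lambda>k. G (cvec x + z *s cvec (u k))) \<longlonglongrightarrow> G (cvec x + z *s cvec w)"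
          unfolding eq by simp
        then show "(\<lambda>k. poly (l (cvec x, cvec (u k))) z) \<longlonglongrightarrow> poly qc z"
          unfolding l[symmetric] q(2)[symmetric] .
      qed
      then show False using False by simp
    qed
    have "Im z = 0" if "poly qc z = 0" for z
    proof (rule ccontr)
      assume "Im z \<noteq> 0"
      then have "Im z > 0 \<or> Im (cnj z) > 0" by auto
      moreover have "poly qc (cnj z) = 0"
        using stable_line_cnj[OF g, of x z w] that q(2) by simp
      ultimately show False using nr that by blast
    qed
    from real_rooted_splits[OF q(3) this] show ?thesis by blast
  qed
  then show ?thesis using that q(1) dd by blast
qed

text \<open>If \<open>g - \<epsilon> D\<^sub>w g\<close> had no zero above \<open>p + t0 e\<close>, it would have none on the ray from there in
  direction \<open>w\<close>, but on that line it is \<open>q - \<epsilon> q'\<close> for a real-rooted \<open>q\<close> vanishing at \<open>-\<epsilon>\<close>.\<close>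

lemma exists_zero_ge_step:
  assumes g: "stable g G" and w: "w \<in> Lam" and eps: "\<epsilon> = 1 \<or> \<epsilon> = -1"
    and z: "g (p + t0 *\<^sub>R e - \<epsilon> *\<^sub>R w) = 0"
  shows "\<exists>t\<ge>t0. g (p + t *\<^sub>R e) - \<epsilon> * dir_deriv w g (p + t *\<^sub>R e) = 0"
proof (rule ccontr)
  assume no: "\<not> ?thesis"
  let ?f = "\<lambda>x. g x - \<epsilon> * dir_deriv w g x"
  obtain F where F: "stable ?f F" using stable_diff_dir_deriv[OF g w] by blast
  have nz: "?f ((p + t0 *\<^sub>R e) + r *\<^sub>R e) \<noteq> 0" if "r \<ge> 0" for r
    using no that by (auto simp: add.assoc scaleR_add_left[symmetric] dest: spec[of _ "t0 + r"])
  \<comment> \<open>The base point is shifted by \<open>- \<epsilon> w\<close>: now \<open>q\<close>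
    vanishes at 0, and the parameter \<epsilon> corresponds to \<open>p + t0 e\<close>.\<close>
  let ?x = "p + t0 *\<^sub>R e - \<epsilon> *\<^sub>R w"
  obtain q L where q: "\<And>s. g (?x + s *\<^sub>R w) = poly q s"
    "\<And>s. dir_deriv w g (?x + s *\<^sub>R w) = poly (pderiv q) s" "q = smult (lead_coeff q) (roots_poly L)"
    using stable_line_Lam[OF g w] by metis
  have "poly q 0 = 0" using q(1)[of 0] z by simp
  from exists_root_shift[OF q(3) this eps]
  obtain s where s: "s \<ge> \<epsilon>" "?f (?x + s *\<^sub>R w) = 0" using q(1,2) by metis
  have eq: "?x + s *\<^sub>R w = (p + t0 *\<^sub>R e) + (s - \<epsilon>) *\<^sub>R w" by (simp add: algebra_simps)
  have "s - \<epsilon> \<ge> 0" using s(1) by simp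
  from stable_nonzero_translate[OF F w nz this] s(2) show False unfolding eq by blast
qed

section \<open>Iteration over the list of vectors\<close>

lemma foldr_stable:
  "set ws \<subseteq> Lam \<Longrightarrow> \<exists>G. stable (foldr (\<lambda>v g x. g x - \<epsilon> * dir_deriv v g x) ws h) G"
proof (induction ws)
  case (Cons w ws)
  then show ?case using stable_diff_dir_deriv[of _ _ w \<epsilon>] by fastforce
qed (use stable_h in auto)

text \<open>The translation by the first vector is absorbed into \<open>p\<close>, which must be
  arbitrary in the induction. The hypothesis gives a zero for \<open>ws\<close> at
  \<open>p + t1 e - \<epsilon> w\<close>, and the single step trades this translation for the factor
  \<open>1 - \<epsilon> D\<^sub>w\<close>.\<close>

lemma exists_zero_ge:
  assumes "set ws \<subseteq> Lam" and eps: "\<epsilon> = 1 \<or> \<epsilon> = -1"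
    and "h (p + t0 *\<^sub>R e - \<epsilon> *\<^sub>R sum_list ws) = 0"
  shows "\<exists>t\<ge>t0. foldr (\<lambda>v g x. g x - \<epsilon> * dir_deriv v g x) ws h (p + t *\<^sub>R e) = 0"
  using assms(1,3)
proof (induction ws arbitrary: p t0)
  case (Cons w ws)
  let ?g = "foldr (\<lambda>v g x. g x - \<epsilon> * dir_deriv v g x) ws h"
  have eq: "(p - \<epsilon> *\<^sub>R w) + t0 *\<^sub>R e - \<epsilon> *\<^sub>R sum_list ws = p + t0 *\<^sub>R e - \<epsilon> *\<^sub>R sum_list (w # ws)"
    by (simp add: algebra_simps)
  have "h ((p - \<epsilon> *\<^sub>R w) + t0 *\<^sub>R e - \<epsilon> *\<^sub>R sum_list ws) = 0"
    unfolding eq by (rule Cons.prems(2))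
  then obtain t1 where t1: "t1 \<ge> t0" "?g ((p - \<epsilon> *\<^sub>R w) + t1 *\<^sub>R e) = 0"
    using Cons.IH[of "p - \<epsilon> *\<^sub>R w" t0] Cons.prems by auto
  obtain G where "stable ?g G" using foldr_stable Cons.prems by fastforce
  moreover have "?g (p + t1 *\<^sub>R e - \<epsilon> *\<^sub>R w) = 0" using t1(2) by (simp add: algebra_simps)
  ultimately obtain t where "t \<ge> t1" "?g (p + t *\<^sub>R e) - \<epsilon> * dir_deriv w ?g (p + t *\<^sub>R e) = 0"
    using exists_zero_ge_step[OF _ _ eps] Cons.prems by fastforce
  then show ?case using t1(1) by (intro exI[of _ t]) simp
qed auto

end

subsection \<open>Eigenvalues and the mixed characteristic polynomial\<close>

text \<open>This gives the uniqueness behind the definite description in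
  \<open>eigenvalues\<close>.\<close>

lemma proots_roots_poly: "proots (roots_poly (L :: 'a::idom multiset)) = L"
proof (induction L)
  case (add l L)
  have "roots_poly L \<noteq> 0" using lead_coeff_roots_poly[of L] by (metis leading_coeff_0_iff zero_neq_one)
  then show ?case using add
    by (simp only: roots_poly_add, subst proots_mult) (simp_all add: proots_linear_factor)
qed (simp add: roots_poly_def)

lemma poly_map_of_real: "poly (map_poly complex_of_real p) (of_real s) = of_real (poly p s)"
  by (induction p) (auto simp: map_poly_pCons)

text \<open>The complexified polynomial from the definition agrees with \<open>qc\<close> at all
  real points, hence equals it, and its zeros are real.\<close>

lemma hyperbolic_imp_hyperbolic_form:
  assumes pf: "poly_fun d h H H" and hom: "\<And>w z. H (w *s z) = w ^ d * H z" and hyp: "hyperbolic h e"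
  shows "hyperbolic_form d h H e"
proof
  fix w x assume w: "Im w \<noteq> 0"
  \<comment> \<open>The definition speaks of \<open>t e - x\<close>, hence the sign.\<close>
  obtain p where p: "\<And>t. poly p t = h (t *\<^sub>R e - (-x))"
    "\<And>z. poly (map_poly complex_of_real p) z = 0 \<Longrightarrow> z \<in> \<real>"
    using hyp unfolding hyperbolic_def by blast
  obtain q qc where q: "\<And>s. h (x + s *\<^sub>R e) = poly q s" "\<And>z. H (cvec x + z *s cvec e) = poly qc z"
    "\<And>s. poly qc (of_real s) = of_real (poly q s)"
    using poly_fun_real_line[OF pf] by blast
  have "range complex_of_real \<subseteq> {z. poly (qc - map_poly complex_of_real p) z = 0}"
    using q(1,3) p(1) by (auto simp: poly_map_of_real add.commute)
  moreover have "infinite (range complex_of_real)"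
    by (simp add: finite_image_iff inj_of_real infinite_UNIV_char_0)
  ultimately have "qc = map_poly complex_of_real p"
    using poly_roots_finite[of "qc - map_poly complex_of_real p"] infinite_super by auto
  then show "H (cvec x + w *s cvec e) \<noteq> 0"
    using p(2)[of w] q(2) w by (auto simp: complex_is_Real_iff)
qed (use pf hom in auto)

context hyperbolic_form
begin

lemma e_in_Lam: "e \<in> Lam"
proof -
  have "e + t *\<^sub>R e = (1 + t) *\<^sub>R e" for t by (simp add: algebra_simps)
  then show ?thesis using h_e by (simp add: Lam_def h_scale)
qed

lemma stable_line_e:
  assumes "stable g G"
  obtains q where "\<And>s. g (x + s *\<^sub>R e) = poly q s" "degree q = d" "lead_coeff q = h e"
proof -
  obtain q where q: "\<And>s. g (x + s *\<^sub>R e) = poly q s" "degree q \<le> d" "complex_of_real (coeff q d) = H (cvec e)"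
    using poly_fun_real_line[of d g G H x e] assms unfolding stable_def by blast
  then have "coeff q d = h e" by (simp add: H_cvec)
  moreover from this have "degree q = d" using q(2) h_e by (simp add: le_antisym le_degree)
  ultimately show ?thesis using that q(1) by blast
qed

text \<open>Existence comes from real-rootedness along \<open>e\<close>, an element of
  \<open>Lam\<close>; uniqueness from recovering the root multiset; the size from the leading
  coefficient \<open>h e \<noteq> 0\<close>.\<close>

lemma eigenvalues:
  shows "h (t *\<^sub>R e - x) = h e * (\<Prod>l\<in>#eigenvalues h e x. t - l)" (is ?eq)
    and "size (eigenvalues h e x) = d"
proof -
  obtain q where q: "\<And>s. h (- x + s *\<^sub>R e) = poly q s" "degree q = d" "lead_coeff q = h e"
    using stable_line_e[OF stable_h] by metis
  obtain q' L where q': "\<And>s. h (- x + s *\<^sub>R e) = poly q' s" "q' = smult (lead_coeff q') (roots_poly L)"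
    using stable_line_Lam[OF stable_h e_in_Lam] by metis
  have "poly q' = poly q" by (rule ext) (simp only: q(1)[symmetric] q'(1)[symmetric])
  then have "q' = q" by (simp add: poly_eq_poly_eq_iff)
  then have qL: "q = smult (h e) (roots_poly L)" using q'(2) q(3) by simp
  have line: "t *\<^sub>R e - x = - x + t *\<^sub>R e" for t by simp
  have L: "h (t *\<^sub>R e - x) = h e * (\<Prod>l\<in>#L. t - l)" for t
    unfolding line q(1) by (simp add: qL poly_roots_poly)
  have eig: "eigenvalues h e x = L"
    unfolding eigenvalues_def
  proof (rule the_equality)
    show "\<forall>t. h (t *\<^sub>R e - x) = h e * (\<Prod>l\<in>#L. t - l)" using L by simp
    fix L' assume "\<forall>t. h (t *\<^sub>R e - x) = h e * (\<Prod>l\<in>#L'. t - l)"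
    then have "poly (roots_poly L') t = poly (roots_poly L) t" for t
      using L h_e by (simp add: poly_roots_poly)
    then have "roots_poly L' = roots_poly L" by (simp add: poly_eq_poly_eq_iff[symmetric] fun_eq_iff)
    then show "L' = L" by (metis proots_roots_poly)
  qed
  show ?eq using L eig by simp
  have "degree q = size L" using h_e by (simp add: qL)
  then show "size (eigenvalues h e x) = d" using q(2) eig by simp
qed

text \<open>Up to sign, \<open>h (v + t e)\<close> is \<open>h e\<close> times the product of the
  \<open>- t - l\<close>, where no factor vanishes if \<open>t > 0\<close> and
  \<open>l \<ge> 0\<close>.\<close>

lemma hyperbolicity_cone_subset_Lam: "hyperbolicity_cone h e \<subseteq> Lam"
proof
  fix v assume "v \<in> hyperbolicity_cone h e"
  then have min: "Min (set_mset (eigenvalues h e v)) \<ge> 0"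
    by (simp add: hyperbolicity_cone_def lambda_min_def)
  have nonneg: "l \<ge> 0" if "l \<in># eigenvalues h e v" for l
    using min Min_le[OF finite_set_mset that] by linarith
  have "h (v + t *\<^sub>R e) \<noteq> 0" if "t > 0" for t
  proof -
    have "h (v + t *\<^sub>R e) = h ((-1) *\<^sub>R ((-t) *\<^sub>R e - v))" by simp
    also have "\<dots> = (-1) ^ d * (h e * (\<Prod>l\<in>#eigenvalues h e v. - t - l))"
      by (simp only: h_scale eigenvalues(1))
    also have "\<dots> \<noteq> 0" using h_e nonneg that by (force simp: prod_mset_zero_iff)
    finally show ?thesis .
  qed
  then show "v \<in> Lam" by (simp add: Lam_def)
qed

section \<open>Zeros of the mixed characteristic polynomial\<close>

lemma mixed_char_poly_poly:
  assumes "set vs \<subseteq> Lam"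
  obtains q where "\<And>t. mixed_char_poly h e vs t = poly q t" "degree q = d" "q \<noteq> 0"
proof -
  obtain G where G: "stable (foldr (\<lambda>v g x. g x - 1 * dir_deriv v g x) vs h) G"
    using foldr_stable[OF assms, of 1] ..
  obtain q where q: "\<And>s. foldr (\<lambda>v g x. g x - 1 * dir_deriv v g x) vs h (0 + s *\<^sub>R e) = poly q s"
    "degree q = d" "lead_coeff q = h e"
    by (rule stable_line_e[OF G, where x = 0]) blast
  have "mixed_char_poly h e vs t = poly q t" for t using q(1)[of t] by (simp add: mixed_char_poly_def)
  moreover have "q \<noteq> 0" using q(3) h_e by auto
  ultimately show ?thesis using that q(2) by blast
qed

lemma exists_mixed_zero_ge:
  assumes "set vs \<subseteq> Lam" "h (t0 *\<^sub>R e - sum_list vs) = 0"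
  shows "\<exists>t\<ge>t0. mixed_char_poly h e vs t = 0"
  using exists_zero_ge[OF assms(1), of 1 0 t0] assms(2) by (simp add: mixed_char_poly_def)

lemma hyperbolic_form_uminus: "hyperbolic_form d h H (- e)"
proof
  fix w x assume "Im w \<noteq> 0"
  then have "H (cvec x + (- w) *s cvec e) \<noteq> 0" by (intro hyp) simp
  then show "H (cvec x + w *s cvec (- e)) \<noteq> 0" by (simp add: cvec_simps vector_smult_rneg vector_smult_lneg)
qed (use pf hom in auto)

text \<open>Negating \<open>e\<close>, the vectors and \<epsilon> together preserves every factor,
  since \<open>1 - (-1) D_(-v) = 1 - D_v\<close>. The parameter changes sign, so a zero above
  \<open>- t0\<close> becomes one below \<open>t0\<close>.\<close>

lemma exists_mixed_zero_le:
  assumes "set vs \<subseteq> Lam" "h (t0 *\<^sub>R e - sum_list vs) = 0"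
  shows "\<exists>t\<le>t0. mixed_char_poly h e vs t = 0"
proof -
  interpret m: hyperbolic_form d h H "- e" by (rule hyperbolic_form_uminus)
  have "- v \<in> m.Lam" if "v \<in> Lam" for v
  proof -
    have eq: "- v + t *\<^sub>R (- e) = (-1) *\<^sub>R (v + t *\<^sub>R e)" for t by simp
    have "h (- v + t *\<^sub>R (- e)) = (-1) ^ d * h (v + t *\<^sub>R e)" for t
      using h_scale[of "-1" "v + t *\<^sub>R e"] eq[of t] by simp
    then show ?thesis using that unfolding m.Lam_def Lam_def by auto
  qed
  then have vs: "set (map uminus vs) \<subseteq> m.Lam" using assms(1) by auto
  have sum: "sum_list (map uminus vs) = - sum_list vs" by (induction vs) auto
  have "dir_deriv (- v) g x = - dir_deriv v g x" for v :: "real ^ 'n" and g x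
    by (simp add: dir_deriv_def sum_negf)
  then have fold: "foldr (\<lambda>v g x. g x - (-1) * dir_deriv v g x) (map uminus vs) h
      = foldr (\<lambda>v g x. g x - dir_deriv v g x) vs h"
    by (simp add: foldr_map comp_def)
  have "h (0 + (- t0) *\<^sub>R (- e) - (-1) *\<^sub>R sum_list (map uminus vs)) = 0"
    using assms(2) by (simp add: sum)
  from m.exists_zero_ge[OF vs disjI2[OF refl] this]
  obtain t where "t \<ge> - t0" "foldr (\<lambda>v g x. g x - dir_deriv v g x) vs h (0 + t *\<^sub>R (- e)) = 0"
    unfolding fold by blast
  then show ?thesis by (intro exI[of _ "- t"]) (simp add: mixed_char_poly_def)
qed

end

theorem theorem5p2:
  fixes h :: "real ^ 'n \<Rightarrow> real" and e :: "real ^ 'n"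
    and d :: nat and vs :: "(real ^ 'n) list"
  assumes "homogeneous_polynomial d h"
    and "hyperbolic h e"
    and "set vs \<subseteq> hyperbolicity_cone h e"
  shows "lambda_max h e (sum_list vs) \<le> mixed_lambda_max h e vs \<and>
         lambda_min h e (sum_list vs) \<ge> mixed_lambda_min h e vs"
proof -
  obtain H where "poly_fun d h H H" "\<And>w z. H (w *s z) = w ^ d * H z"
    by (rule homogeneous_polynomial_poly_fun[OF assms(1)]) blast
  then interpret hyperbolic_form d h H e
    using hyperbolic_imp_hyperbolic_form assms(2) by blast
  have vs: "set vs \<subseteq> Lam" using assms(3) hyperbolicity_cone_subset_Lam by blast
  obtain q where q: "\<And>t. mixed_char_poly h e vs t = poly q t" "degree q = d" "q \<noteq> 0"
    by (rule mixed_char_poly_poly[OF vs]) blast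
  let ?Z = "{t. mixed_char_poly h e vs t = 0}" and ?E = "set_mset (eigenvalues h e (sum_list vs))"
  have fin: "finite ?Z" unfolding q(1) by (rule poly_roots_finite[OF q(3)])
  show ?thesis
  proof (cases "d = 0")
    \<comment> \<open>For \<open>d = 0\<close> both sets are empty, and each inequality compares the
      default value \<open>Max {}\<close> or \<open>Min {}\<close> with itself.\<close>
    case True
    then obtain c where "q = [:c:]" using q(2) by (metis degree_eq_zeroE)
    then have "?Z = {}" using q by simp
    moreover have "?E = {}" using eigenvalues(2)[of "sum_list vs"] True by simp
    ultimately show ?thesis
      by (simp add: lambda_max_def lambda_min_def mixed_lambda_max_def mixed_lambda_min_def)
  next
    case False
    then have ne: "?E \<noteq> {}" using eigenvalues(2)[of "sum_list vs"] by auto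
    have zero: "h (l *\<^sub>R e - sum_list vs) = 0" if "l \<in> ?E" for l
      using that by (simp add: eigenvalues(1) prod_mset_zero_iff)
    have "Max ?E \<in> ?E" "Min ?E \<in> ?E" using ne by (simp_all add: Max_in Min_in)
    then obtain t t' where "t \<ge> Max ?E" "t \<in> ?Z" "t' \<le> Min ?E" "t' \<in> ?Z"
      using exists_mixed_zero_ge[OF vs zero] exists_mixed_zero_le[OF vs zero] by blast
    then have "Max ?E \<le> Max ?Z" "Min ?Z \<le> Min ?E"
      using Max_ge[OF fin, of t] Min_le[OF fin, of t'] by linarith+
    then show ?thesis
      by (simp add: lambda_max_def lambda_min_def mixed_lambda_max_def mixed_lambda_min_def)
  qed
qed

end
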